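(* Let $\Lambda=a\Lambda_0+b\Lambda_1$ with $a\ge1$, and let $\lambda=(\lambda^1,\dots,\lambda^r)$ be a non-increasing residue-homogeneous multipartition with $\lambda^1\ne\emptyset$ that labels an element of $B(\Lambda)$. Let $N=\lambda^1_1$ be the first part of $\lambda^1$. Then $\lambda$ has a standard LS-representation with respect to the ceiling $\psi^-_N$; that is, with $c_j,d_j,e_j$ as in the context, $0=e_{N+1}\le e_N\le\dots\le e_0=1$ and the Littelmann path of $\lambda$ is the concatenation over $j=N,\dots,0$ of straight pieces in direction $\psi^-_j$ on the parameter intervals $[e_{j+1},e_j]$.
   Context: Setting (level $r$, $e=2$): affine $A^{(1)}_1$, simple roots $\alpha_0,\alpha_1$, $a\ge1,b\ge0$, $r=a+b$, $\Lambda=a\Lambda_0+b\Lambda_1$. Elements of $B(\Lambda)$ are labelled by Kleshchev $r$-multipartitions $\lambda=(\lambda^1,\dots,\lambda^r)$ (Ariki–Mathas, $e$-regular convention); components $1,\dots,a$ are $0$-corner (node $(x,y)$ of residue $(y-x)\bmod2$), components $a+1,\dots,r$ are $1$-corner (residue $(1+y-x)\bmod 2$); the weight of $\lambda$ is $\Lambda-\sum_{\text{nodes}}\alpha_{\mathrm{res}}$. $B(\Lambda)$ is also realized by Littelmann LS paths; "the Littelmann path of $\lambda$" is its image under the unique crystal isomorphism. A partition is alternating if its nonzero parts are distinct and their parities alternate. $\lambda$ is \emph{residue-homogeneous} if (i) every nonempty component is alternating with odd last part; (ii) the first parts of the nonempty $0$-corner components all have the same parity and those of the nonempty $1$-corner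 components the opposite parity; (iii) for each $2\le j\le r$ with $\lambda^j\neq\emptyset$ of first part $n$: if $j\ne a+1$, the last $n$ parts of $\lambda^{j-1}$ are $n,n-1,\dots,1$; if $j=a+1$, the last parts of $\lambda^a$ are $n+1,n,\dots,1$ or $n-1,\dots,1$. It is \emph{non-increasing} if, in (iii) at $j=a+1$ (when $\lambda^{a+1}\ne\emptyset$), the first option $n+1,n,\dots,1$ holds. Defect-zero weights: for $j\ge0$ let $Y_j$ be the multipartition whose $0$-corner components are $(j,j-1,\dots,1)$ and whose $1$-corner components are $(j-1,\dots,1)$ (empty when $j\le 1$); $\psi^-_j$ is its weight ($\psi^-_0=\Lambda$, $\psi^-_j=s_{i_j}\psi^-_{j-1}$ with $i_j\equiv j-1\bmod 2$). Put $d_j=|Y_j\setminus Y_{j-1}|=rj-b$, $c_j=|(Y_j\setminus Y_{j-1})\cap Y(\lambda)|$, $e_j=c_j/d_j$ for $1\le j\le N$, $e_0=1$, $e_{N+1}=0$. *)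

theory Defs
  imports "HOL-Analysis.Analysis"
begin

text \<open>A multipartition is a list of a+b partitions (lists of positive parts, weakly
decreasing). Components are 0-indexed: components 0..a-1 are 0-corner (charge 0),
components a..a+b-1 are 1-corner (charge 1). A node is (k,x,y): component k,
row x >= 1, column y >= 1.\<close>

type_synonym mpart = "nat list list"
type_synonym node = "nat \<times> nat \<times> nat"

definition res :: "nat \<Rightarrow> nat \<Rightarrow> nat \<Rightarrow> nat \<Rightarrow> nat" where
  "res a k x y = nat ((int y - int x + (if k < a then 0 else 1)) mod 2)"

definition nres :: "nat \<Rightarrow> node \<Rightarrow> nat" where
  "nres a n = res a (fst n) (fst (snd n)) (snd (snd n))"

definition part :: "mpart \<Rightarrow> nat \<Rightarrow> nat \<Rightarrow> nat" where
  "part lam k x = (if 1 \<le> x \<and> x \<le> length (lam ! k) then lam ! k ! (x - 1) else 0)"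

definition ydiag :: "mpart \<Rightarrow> node set" where
  "ydiag lam = {(k, x, y). k < length lam \<and> 1 \<le> x \<and> 1 \<le> y \<and> y \<le> part lam k x}"

definition addn :: "nat \<Rightarrow> mpart \<Rightarrow> nat \<Rightarrow> node set" where
  "addn a lam i = {(k, x, y). k < length lam \<and> 1 \<le> x \<and> y = Suc (part lam k x)
      \<and> (x = 1 \<or> y \<le> part lam k (x - 1)) \<and> res a k x y = i}"

definition remn :: "nat \<Rightarrow> mpart \<Rightarrow> nat \<Rightarrow> node set" where
  "remn a lam i = {(k, x, y). k < length lam \<and> 1 \<le> x \<and> 1 \<le> y \<and> y = part lam k x
      \<and> part lam k (Suc x) < y \<and> res a k x y = i}"

definition above :: "node \<Rightarrow> node \<Rightarrow> bool" where
  "above P Q \<longleftrightarrow> fst P < fst Q \<or> (fst P = fst Q \<and> fst (snd P) < fst (snd Q))"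

text \<open>i-signature read from top to bottom; an addable node followed (below) by a removable
node cancel (bracket matching). An addable i-node is conormal iff it survives the cancellation;
the cogood node is the topmost conormal node, and f_i adds it.\<close>
definition conormal :: "nat \<Rightarrow> mpart \<Rightarrow> nat \<Rightarrow> node \<Rightarrow> bool" where
  "conormal a lam i B \<longleftrightarrow> B \<in> addn a lam i \<and>
     (\<forall>C \<in> addn a lam i \<union> remn a lam i. above B C \<longrightarrow>
        card {D \<in> remn a lam i. above B D \<and> \<not> above C D}
          \<le> card {D \<in> addn a lam i. above B D \<and> \<not> above C D})"

definition cogood :: "nat \<Rightarrow> mpart \<Rightarrow> nat \<Rightarrow> node \<Rightarrow> bool" where
  "cogood a lam i B \<longleftrightarrow> conormal a lam i B \<and> (\<forall>B'. conormal a lam i B' \<longrightarrow> B' = B \<or> above B B')"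

definition add_node :: "mpart \<Rightarrow> node \<Rightarrow> mpart" where
  "add_node lam n = (let k = fst n; x = fst (snd n); y = snd (snd n) in
     lam[k := (if x \<le> length (lam ! k) then (lam ! k)[x - 1 := y] else lam ! k @ [y])])"

definition fm :: "nat \<Rightarrow> nat \<Rightarrow> mpart \<Rightarrow> mpart option" where
  "fm a i lam = (if \<exists>B. cogood a lam i B then Some (add_node lam (THE B. cogood a lam i B)) else None)"

fun applyM :: "nat \<Rightarrow> nat list \<Rightarrow> mpart \<Rightarrow> mpart option" where
  "applyM a [] lam = Some lam"
| "applyM a (i # is) lam = (case fm a i lam of None \<Rightarrow> None | Some l \<Rightarrow> applyM a is l)"

text \<open>Kleshchev multipartitions = elements of B(Lambda): those reachable from the empty
multipartition by the crystal operators f_i (the first element of the list is applied first).\<close>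
definition kleshchev :: "nat \<Rightarrow> nat \<Rightarrow> mpart \<Rightarrow> bool" where
  "kleshchev a b lam \<longleftrightarrow> (\<exists>is. applyM a is (replicate (a + b) []) = Some lam)"

section \<open>Weights of affine A_1^(1): coordinates w.r.t. (Lambda_0, Lambda_1, delta)\<close>

type_synonym wt = "real \<times> real \<times> real"

definition alpha :: "nat \<Rightarrow> wt" where
  "alpha i = (if i = 0 then (2, -2, 1) else (-2, 2, 0))"

definition coroot :: "nat \<Rightarrow> wt \<Rightarrow> real" where
  "coroot i v = (if i = 0 then fst v else fst (snd v))"

definition Lam :: "nat \<Rightarrow> nat \<Rightarrow> wt" where
  "Lam a b = (real a, real b, 0)"

definition weight :: "nat \<Rightarrow> nat \<Rightarrow> mpart \<Rightarrow> wt" where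
  "weight a b lam = Lam a b
     - real (card {n \<in> ydiag lam. nres a n = 0}) *\<^sub>R alpha 0
     - real (card {n \<in> ydiag lam. nres a n = 1}) *\<^sub>R alpha 1"

type_synonym path = "real \<Rightarrow> wt"

definition sref :: "nat \<Rightarrow> wt \<Rightarrow> wt" where
  "sref i v = v - coroot i v *\<^sub>R alpha i"

definition fp :: "nat \<Rightarrow> path \<Rightarrow> path option" where
  "fp i \<pi> = (if i > 1 then None else
     (let h = (\<lambda>t. coroot i (\<pi> t)); m = Inf (h ` {0..1}) in
      if h 1 - m < 1 then None else
      (let t0 = Sup {t \<in> {0..1}. h t = m}; t1 = Inf {t \<in> {t0..1}. h t = m + 1} in
       Some (\<lambda>t. if t \<le> t0 then \<pi> t
                 else if t \<le> t1 then \<pi> t0 + sref i (\<pi> t - \<pi> t0)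
                 else \<pi> t - alpha i))))"

fun applyP :: "nat list \<Rightarrow> path \<Rightarrow> path option" where
  "applyP [] p = Some p"
| "applyP (i # is) p = (case fp i p of None \<Rightarrow> None | Some q \<Rightarrow> applyP is q)"

definition straight :: "nat \<Rightarrow> nat \<Rightarrow> path" where
  "straight a b = (\<lambda>t. t *\<^sub>R Lam a b)"

text \<open>The Littelmann path of a Kleshchev multipartition lam is the image under the unique
crystal isomorphism, which sends f_{i_k}...f_{i_1} of the empty multipartition to
f_{i_k}...f_{i_1} of the straight line path to Lambda.\<close>
definition littelmann_path_is :: "nat \<Rightarrow> nat \<Rightarrow> mpart \<Rightarrow> path \<Rightarrow> bool" where
  "littelmann_path_is a b lam \<pi> \<longleftrightarrow>
     (\<forall>is. applyM a is (replicate (a + b) []) = Some lam \<longrightarrow>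
        (\<exists>\<pi>'. applyP is (straight a b) = Some \<pi>' \<and> (\<forall>t \<in> {0..1}. \<pi>' t = \<pi> t)))"

definition stair :: "nat \<Rightarrow> nat list" where
  "stair n = rev [1..<Suc n]"

definition alternating :: "nat list \<Rightarrow> bool" where
  "alternating p \<longleftrightarrow> distinct (filter (\<lambda>x. x \<noteq> 0) p) \<and>
     (\<forall>i. Suc i < length (filter (\<lambda>x. x \<noteq> 0) p) \<longrightarrow>
        (even (filter (\<lambda>x. x \<noteq> 0) p ! i) \<longleftrightarrow> odd (filter (\<lambda>x. x \<noteq> 0) p ! Suc i)))"

definition res_homog :: "nat \<Rightarrow> nat \<Rightarrow> mpart \<Rightarrow> bool" where
  "res_homog a b lam \<longleftrightarrow>
     (\<forall>k < a + b. lam ! k \<noteq> [] \<longrightarrow> alternating (lam ! k) \<and> odd (last (lam ! k)))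
   \<and> (\<exists>P. \<forall>k < a + b. lam ! k \<noteq> [] \<longrightarrow> (even (hd (lam ! k)) \<longleftrightarrow> (if k < a then P else \<not> P)))
   \<and> (\<forall>k. 1 \<le> k \<and> k < a + b \<and> lam ! k \<noteq> [] \<longrightarrow>
        (if k \<noteq> a then (\<exists>u. lam ! (k - 1) = u @ stair (hd (lam ! k)))
         else ((\<exists>u. lam ! (k - 1) = u @ stair (Suc (hd (lam ! k))))
               \<or> (\<exists>u. lam ! (k - 1) = u @ stair (hd (lam ! k) - 1)))))"

definition non_increasing :: "nat \<Rightarrow> nat \<Rightarrow> mpart \<Rightarrow> bool" where
  "non_increasing a b lam \<longleftrightarrow>
     (a < a + b \<and> lam ! a \<noteq> [] \<longrightarrow> (\<exists>u. lam ! (a - 1) = u @ stair (Suc (hd (lam ! a)))))"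

definition Yst :: "nat \<Rightarrow> nat \<Rightarrow> nat \<Rightarrow> mpart" where
  "Yst a b j = replicate a (stair j) @ replicate b (stair (j - 1))"

definition psi :: "nat \<Rightarrow> nat \<Rightarrow> nat \<Rightarrow> wt" where
  "psi a b j = weight a b (Yst a b j)"

definition dcoef :: "nat \<Rightarrow> nat \<Rightarrow> nat \<Rightarrow> nat" where
  "dcoef a b j = card (ydiag (Yst a b j) - ydiag (Yst a b (j - 1)))"

definition ccoef :: "nat \<Rightarrow> nat \<Rightarrow> mpart \<Rightarrow> nat \<Rightarrow> nat" where
  "ccoef a b lam j = card ((ydiag (Yst a b j) - ydiag (Yst a b (j - 1))) \<inter> ydiag lam)"

definition ecoef :: "nat \<Rightarrow> nat \<Rightarrow> mpart \<Rightarrow> nat \<Rightarrow> nat \<Rightarrow> real" where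
  "ecoef a b lam N j = (if j = 0 then 1 else if j \<le> N then real (ccoef a b lam j) / real (dcoef a b j) else 0)"

text \<open>Concatenation over j = N,...,0 of straight pieces in direction psi_j on [e_{j+1}, e_j].\<close>
definition std_path :: "nat \<Rightarrow> nat \<Rightarrow> mpart \<Rightarrow> nat \<Rightarrow> path" where
  "std_path a b lam N = (\<lambda>t. \<Sum>j \<in> {0..N}.
     max 0 (min t (ecoef a b lam N j) - ecoef a b lam N (Suc j)) *\<^sub>R psi a b j)"

end

theory Submission
  imports Defs
begin

text \<open>Call \<open>x + y - 1\<close> (plus 1 in a 1-corner component) the level of a node, so that \<open>c\<^sub>j\<close> counts the
nodes of level \<open>j\<close> and a node of level \<open>j\<close> has residue \<open>j + 1\<close> modulo 2. Along the standard path the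
pairing with a simple coroot alternately falls and rises, and all its local minima are integers
because \<open>2 d\<^sub>j = d\<^bsub>j-1\<^esub> + d\<^bsub>j+1\<^esub>\<close>. Hence, as long as the new breakpoints are still monotone, the root
operator \<open>f\<^sub>i\<close> moves exactly one breakpoint, raising by one the \<open>c\<^sub>j\<close> at which the minimum is
attained last.

On the other side, the partial sums of the \<open>i\<close>-signature are the negatives of these minima as soon
as the row ends, read from top to bottom, have weakly decreasing levels. This is so for the
multipartitions with strict components in which the first part of a component is at most the
length of the preceding one (minus 1 when passing to the 1-corner components). Non-increasing
residue-homogeneous multipartitions have this form, and the form is inherited by predecessors
under every \<open>f\<^sub>i\<close>; therefore every sequence of operators leading to the multipartition gives the
standard path.\<close>

section \<open>Root operators on standard paths\<close>

definition dlev :: "nat \<Rightarrow> nat \<Rightarrow> nat \<Rightarrow> nat" where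
  "dlev a b p = a * p + b * (p - 1)"

text \<open>The standard path after Abel summation: consecutive directions differ by
\<open>d\<^sub>p\<close> times a simple root, so the breakpoints \<open>c\<^sub>p / d\<^sub>p\<close> enter one summand each.\<close>
definition level_path :: "nat \<Rightarrow> nat \<Rightarrow> nat \<Rightarrow> (nat \<Rightarrow> nat) \<Rightarrow> path" where
  "level_path a b K c t = t *\<^sub>R Lam a b
     - (\<Sum>p = 1..K. min (t * real (dlev a b p)) (real (c p)) *\<^sub>R alpha (Suc p mod 2))"

text \<open>The breakpoints c_q/d_q are at most 1 (note d_1 = \<open>a\<close>) and weakly
  decreasing in q, cross-multiplied to stay within the natural numbers.\<close>

definition ls_seq :: "nat \<Rightarrow> nat \<Rightarrow> (nat \<Rightarrow> nat) \<Rightarrow> bool" where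
  "ls_seq a b c \<longleftrightarrow> c 1 \<le> a \<and> (\<forall>q\<ge>1. c (Suc q) * dlev a b q \<le> c q * dlev a b (Suc q))"

definition alt_sign :: "nat \<Rightarrow> nat \<Rightarrow> int" where
  "alt_sign j p = (if even (p + j) then -1 else 1)"

definition alt_tail :: "nat \<Rightarrow> (nat \<Rightarrow> nat) \<Rightarrow> nat \<Rightarrow> nat \<Rightarrow> int" where
  "alt_tail K c j q = (\<Sum>p = Suc q..K. alt_sign j p * int (c p))"

text \<open>For \<open>p \<equiv> j\<close> modulo 2 the pairing of the path with the coroot of index \<open>Suc j mod 2\<close> has its local
minimum at the end of piece \<open>p\<close>, with value the integer \<open>-dip p\<close>.\<close>
definition dip :: "nat \<Rightarrow> (nat \<Rightarrow> nat) \<Rightarrow> nat \<Rightarrow> nat \<Rightarrow> int" where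
  "dip K c j p = int (c p) - 2 * alt_tail K c j p"

section \<open>The pairing with a simple coroot on each straight piece\<close>

lemma coroot_simps:
  "coroot i (u - v) = coroot i u - coroot i v"
  "coroot i (x *\<^sub>R u) = x * coroot i u"
  by (auto simp: coroot_def)

lemma coroot_sum: "coroot i (sum f S) = (\<Sum>x\<in>S. coroot i (f x))"
  by (induction S rule: infinite_finite_induct) (auto simp: coroot_def)

lemma coroot_alpha:
  assumes "i = Suc j mod 2"
  shows "coroot i (alpha (Suc p mod 2)) = - 2 * alt_sign j p"
  using assms by (auto simp: coroot_def alpha_def alt_sign_def mod2_eq_if)

lemma coroot_level_path:
  assumes "i = Suc j mod 2"
  shows "coroot i (level_path a b K c t) = t * coroot i (Lam a b)
     + 2 * (\<Sum>p = 1..K. alt_sign j p * min (t * real (dlev a b p)) (real (c p)))"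
  unfolding level_path_def coroot_simps coroot_sum coroot_alpha[OF assms]
  by (simp add: sum_distrib_left sum_negf algebra_simps)

lemma dlev_pos: "1 \<le> a \<Longrightarrow> 1 \<le> p \<Longrightarrow> 0 < dlev a b p"
  by (simp add: dlev_def)

text \<open>At \<open>q = 0\<close> the weight on the right is \<open>-d\<^sub>0 = b\<close>, outside the range of the natural
number \<open>dlev\<close>; the real expression \<open>(a + b) q - b\<close> covers it.\<close>
lemma coroot_extremal:
  assumes "i = Suc j mod 2"
  shows "coroot i (Lam a b) + 2 * (\<Sum>p = 1..q. alt_sign j p * real (dlev a b p))
       = (if even (q + j) then real b - real (a + b) * real q
          else real (a + b) * real (Suc q) - real b)"
proof (induction q)
  case 0
  then show ?case using assms
    by (auto simp: coroot_def Lam_def mod2_eq_if)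
next
  case (Suc q)
  have "real (dlev a b (Suc q)) = real (a + b) * real (Suc q) - real b"
    by (simp add: dlev_def algebra_simps)
  with Suc show ?case
    by (auto simp: alt_sign_def algebra_simps)
qed

text \<open>In terms of breakpoints this is t \<le> c_q/d_q \<le> c_p/d_p; the induction clears the
  positive denominators one step at a time. The companion \<open>ls_seq_up\<close> is the mirror
  image.\<close>

lemma ls_seq_down:
  assumes "1 \<le> a" "ls_seq a b c" "1 \<le> p" "p \<le> q" "t * real (dlev a b q) \<le> real (c q)"
  shows "t * real (dlev a b p) \<le> real (c p)"
  using assms(4,5)
proof (induction q rule: dec_induct)
  case base then show ?case by simp
next
  case (step q)
  have pos: "0 < real (dlev a b q)" "0 < real (dlev a b (Suc q))"
    using dlev_pos[OF assms(1)] step.hyps assms(3) by auto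
  have "c (Suc q) * dlev a b q \<le> c q * dlev a b (Suc q)"
    using assms(2,3) step.hyps unfolding ls_seq_def by auto
  then have "real (c (Suc q)) * real (dlev a b q) \<le> real (c q) * real (dlev a b (Suc q))"
    by (metis of_nat_le_iff of_nat_mult)
  moreover have "(t * real (dlev a b (Suc q))) * real (dlev a b q) \<le> real (c (Suc q)) * real (dlev a b q)"
    using step.prems pos by (intro mult_right_mono) auto
  ultimately have "(t * real (dlev a b q)) * real (dlev a b (Suc q)) \<le> real (c q) * real (dlev a b (Suc q))"
    by (simp add: mult_ac)
  then have "t * real (dlev a b q) \<le> real (c q)"
    using pos by (simp add: mult_le_cancel_right)
  then show ?case by (rule step.IH)
qed

lemma ls_seq_up:
  assumes "1 \<le> a" "ls_seq a b c" "1 \<le> q" "q \<le> p" "real (c q) \<le> t * real (dlev a b q)"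
  shows "real (c p) \<le> t * real (dlev a b p)"
  using assms(4,5)
proof (induction p rule: dec_induct)
  case base then show ?case by simp
next
  case (step p)
  have pos: "0 < real (dlev a b p)" "0 < real (dlev a b (Suc p))"
    using dlev_pos[OF assms(1)] step.hyps assms(3) by auto
  have "c (Suc p) * dlev a b p \<le> c p * dlev a b (Suc p)"
    using assms(2,3) step.hyps unfolding ls_seq_def by auto
  then have "real (c (Suc p)) * real (dlev a b p) \<le> real (c p) * real (dlev a b (Suc p))"
    by (metis of_nat_le_iff of_nat_mult)
  also have "\<dots> \<le> (t * real (dlev a b p)) * real (dlev a b (Suc p))"
    using step.IH[OF step.prems] pos by (intro mult_right_mono) auto
  finally have "real (c (Suc p)) * real (dlev a b p) \<le> (t * real (dlev a b (Suc p))) * real (dlev a b p)"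
    by (simp add: mult_ac)
  then show ?case using pos by (simp add: mult_le_cancel_right)
qed

text \<open>The hypotheses place t between the breakpoints of indices \<open>Suc q\<close> and
  \<open>q\<close>. There the minima with p \<le> q still grow linearly, giving the slope computed
  in \<open>coroot_extremal\<close>, while those with p > q are saturated at \<open>c p\<close> and
  give the constant term. For \<open>q = 0\<close> there is no upper breakpoint.\<close>

lemma height_segment:
  assumes "1 \<le> a" "ls_seq a b c" "i = Suc j mod 2" "q \<le> K"
    and "q = 0 \<or> t * real (dlev a b q) \<le> real (c q)"
    and "real (c (Suc q)) \<le> t * real (dlev a b (Suc q))"
  shows "coroot i (level_path a b K c t)
     = t * (if even (q + j) then real b - real (a + b) * real q
            else real (a + b) * real (Suc q) - real b) + 2 * alt_tail K c j q"
proof -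
  have eq: "{1..K} = {1..q} \<union> {Suc q..K}" using assms(4) by auto
  have "(\<Sum>p = 1..K. alt_sign j p * min (t * real (dlev a b p)) (real (c p)))
      = (\<Sum>p = 1..q. alt_sign j p * min (t * real (dlev a b p)) (real (c p)))
      + (\<Sum>p = Suc q..K. alt_sign j p * min (t * real (dlev a b p)) (real (c p)))"
    unfolding eq by (rule sum.union_disjoint) auto
  also have "(\<Sum>p = 1..q. alt_sign j p * min (t * real (dlev a b p)) (real (c p)))
      = (\<Sum>p = 1..q. alt_sign j p * (t * real (dlev a b p)))"
  proof (rule sum.cong[OF refl])
    fix p assume "p \<in> {1..q}"
    then have "t * real (dlev a b p) \<le> real (c p)"
      using ls_seq_down[OF assms(1,2), of p q t] assms(5) by auto
    then show "alt_sign j p * min (t * real (dlev a b p)) (real (c p)) = alt_sign j p * (t * real (dlev a b p))"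
      by simp
  qed
  also have "(\<Sum>p = Suc q..K. alt_sign j p * min (t * real (dlev a b p)) (real (c p)))
      = (\<Sum>p = Suc q..K. alt_sign j p * real (c p))"
  proof (rule sum.cong[OF refl])
    fix p assume "p \<in> {Suc q..K}"
    then have "real (c p) \<le> t * real (dlev a b p)"
      using ls_seq_up[OF assms(1,2), of "Suc q" p t] assms(6) by auto
    then show "alt_sign j p * min (t * real (dlev a b p)) (real (c p)) = alt_sign j p * (real (c p))"
      by simp
  qed
  finally have s: "(\<Sum>p = 1..K. alt_sign j p * min (t * real (dlev a b p)) (real (c p)))
     = t * (\<Sum>p = 1..q. alt_sign j p * real (dlev a b p)) + alt_tail K c j q"
    by (simp add: alt_tail_def sum_distrib_left algebra_simps)
  show ?thesis
    unfolding coroot_level_path[OF assms(3)] s coroot_extremal[OF assms(3), of a b q, symmetric]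
    by (simp add: algebra_simps)
qed

lemma alt_tail_Suc:
  assumes "q < K"
  shows "alt_tail K c j q = alt_sign j (Suc q) * int (c (Suc q)) + alt_tail K c j (Suc q)"
  unfolding alt_tail_def using assms by (simp add: sum.atLeast_Suc_atMost)

lemma dip_eq_prev:
  assumes "q < K" "odd (q + j)"
  shows "dip K c j (Suc q) = - int (c (Suc q)) - 2 * alt_tail K c j q"
  using assms by (simp add: dip_def alt_tail_Suc alt_sign_def)

lemma dlev_real: "1 \<le> p \<Longrightarrow> real (dlev a b p) = real (a + b) * real p - real b"
  by (cases p) (simp_all add: dlev_def algebra_simps)

text \<open>Piece \<open>q\<close> ends at t = c_q/d_q, where the bracket vanishes; the slope on it
  is -d_q. The next lemma describes a rising piece \<open>q\<close> from its left end, which is the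
  minimum at the end of piece \<open>Suc q\<close>.\<close>

lemma height_descending:
  assumes "1 \<le> a" "ls_seq a b c" "i = Suc j mod 2" "q \<le> K" "1 \<le> q" "even (q + j)"
    and "t * real (dlev a b q) \<le> real (c q)"
    and "real (c (Suc q)) \<le> t * real (dlev a b (Suc q))"
  shows "coroot i (level_path a b K c t) = - real_of_int (dip K c j q) + (real (c q) - t * real (dlev a b q))"
  using height_segment[OF assms(1-4) _ assms(8)] assms(5,6,7)
  by (simp add: dip_def dlev_real algebra_simps)

lemma height_ascending:
  assumes "1 \<le> a" "ls_seq a b c" "i = Suc j mod 2" "q < K" "odd (q + j)"
    and "q = 0 \<or> t * real (dlev a b q) \<le> real (c q)"
    and "real (c (Suc q)) \<le> t * real (dlev a b (Suc q))"
  shows "coroot i (level_path a b K c t)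
     = - real_of_int (dip K c j (Suc q)) + (t * real (dlev a b (Suc q)) - real (c (Suc q)))"
  using height_segment[OF assms(1-3) _ assms(6,7)] assms(4,5)
  by (simp add: dip_eq_prev dlev_real algebra_simps)

text \<open>On the last piece, in direction \<Lambda>, the pairing has slope \<open>b\<close>, which
  is nonnegative. It is therefore bounded below by its value at the left end c_1/a, up to which
  piece 1 has been rising with slope d_2 from the minimum indexed by 2.\<close>

lemma height_fundamental:
  assumes "1 \<le> a" "ls_seq a b c" "1 = Suc j mod 2" "2 \<le> K" "0 \<le> t"
    and "real (c 1) \<le> t * real a"
  shows "coroot 1 (level_path a b K c t)
     \<ge> - real_of_int (dip K c j 2) + (real (c 1) / real a * real (dlev a b 2) - real (c 2))"
proof -
  have ev: "even j" using assms(3) by (auto simp: mod2_eq_if split: if_splits)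
  have "coroot 1 (level_path a b K c t) = t * real b + 2 * alt_tail K c j 0"
    using height_segment[OF assms(1-3), of 0 K t] assms(6) ev by (simp add: dlev_def)
  moreover have "alt_tail K c j 0 = int (c 1) + alt_tail K c j 1"
    using alt_tail_Suc[of 0 K c j] assms(4) ev by (simp add: alt_sign_def)
  moreover have "dip K c j 2 = - int (c 2) - 2 * alt_tail K c j 1"
    using dip_eq_prev[of 1 K j c, unfolded Suc_1] assms(4) ev by simp
  moreover have "real (c 1) / real a * real b \<le> t * real b"
    using assms(1,6) by (intro mult_right_mono) (auto simp: divide_simps)
  moreover have "real (c 1) / real a * real (dlev a b 2) = 2 * real (c 1) + real (c 1) / real a * real b"
    using assms(1) by (simp add: dlev_def field_simps)
  ultimately show ?thesis by simp
qed

section \<open>The root operator moves one breakpoint\<close>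

lemma segment_exists:
  assumes "1 \<le> a" "c (Suc K) = 0" "0 \<le> t"
  obtains q where "q \<le> K" "real (c (Suc q)) \<le> t * real (dlev a b (Suc q))"
    "q = 0 \<or> t * real (dlev a b q) \<le> real (c q)"
    "\<And>s. real (c (Suc s)) \<le> t * real (dlev a b (Suc s)) \<Longrightarrow> q \<le> s"
proof -
  define Q where "Q = (\<lambda>q. real (c (Suc q)) \<le> t * real (dlev a b (Suc q)))"
  have QK: "Q K" using assms by (simp add: Q_def)
  show thesis
  proof (rule that[of "Least Q"])
    show "Least Q \<le> K" by (rule Least_le[of Q, OF QK])
    show "real (c (Suc (Least Q))) \<le> t * real (dlev a b (Suc (Least Q)))"
      using LeastI[of Q, OF QK] by (simp add: Q_def)
    show "Least Q = 0 \<or> t * real (dlev a b (Least Q)) \<le> real (c (Least Q))"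
    proof (cases "Least Q")
      case (Suc q)
      then have "\<not> Q q" using not_less_Least[of q Q] by simp
      then show ?thesis using Suc by (simp add: Q_def)
    qed simp
    show "\<And>s. real (c (Suc s)) \<le> t * real (dlev a b (Suc s)) \<Longrightarrow> Least Q \<le> s"
      by (rule Least_le) (simp add: Q_def)
  qed
qed

text \<open>Larger indices are traversed earlier, so \<open>before\<close> and \<open>after\<close>
  say that the minimum is attained at the end of piece \<open>j\<close> and at no later time. From
  there the pairing rises by one on piece \<open>j - 1\<close> until t = (c_j + 1)/d_j. Reflecting
  this stretch continues direction \<open>j\<close> up to the new breakpoint, which replaces
  \<open>c j\<close> by \<open>Suc (c j)\<close>.\<close>

lemma fp_level_path:
  assumes a1: "1 \<le> a" and ij: "i = Suc j mod 2" and j1: "1 \<le> j" and jK: "j < K"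
    and ls: "ls_seq a b c" and ls': "ls_seq a b (c(j := Suc (c j)))"
    and cK: "\<And>p. K \<le> p \<Longrightarrow> c p = 0"
    and before: "\<And>p. j < p \<Longrightarrow> even (p + j) \<Longrightarrow> dip K c j p \<le> dip K c j j"
    and after: "\<And>p. 1 \<le> p \<Longrightarrow> p < j \<Longrightarrow> even (p + j) \<Longrightarrow> dip K c j p < dip K c j j"
    and pi: "\<And>t. t \<in> {0..1} \<Longrightarrow> \<pi> t = level_path a b K c t"
  obtains \<pi>' where "fp i \<pi> = Some \<pi>'"
    "\<And>t. t \<in> {0..1} \<Longrightarrow> \<pi>' t = level_path a b K (c(j := Suc (c j))) t"
proof -
  define c' where "c' = c(j := Suc (c j))"
  define h where "h = (\<lambda>t. coroot i (\<pi> t))"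
  define hh where "hh = (\<lambda>t. coroot i (level_path a b K c t))"
  define m where "m = - real_of_int (dip K c j j)"
  define d where "d = real (dlev a b j)"
  have dpos: "0 < d" using dlev_pos[OF a1 j1] by (simp add: d_def)
  define t0 where "t0 = real (c j) / d"
  define t1 where "t1 = real (Suc (c j)) / d"
  have t01: "t0 * d = real (c j)" "t1 * d = real (c j) + 1" using dpos by (simp_all add: t0_def t1_def)
  have t0lt: "t0 < t1" "0 \<le> t0" using dpos by (simp_all add: t0_def t1_def divide_strict_right_mono)
  \<comment> \<open>Monotonicity of the new sequence keeps \<open>t1\<close> from passing the end of
    piece \<open>j - 1\<close>, so the whole interval from \<open>t0\<close> to \<open>t1\<close>
    lies in a single piece. Piece 0 has no such end.\<close>
  have prev: "j = 1 \<or> t1 * real (dlev a b (j - 1)) \<le> real (c (j - 1))"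
  proof (cases "j = 1")
    case False
    have "t1 * real (dlev a b j) \<le> real (c' j)" using t01 by (simp add: c'_def d_def)
    from ls_seq_down[OF a1 ls'[folded c'_def] _ _ this, of "j - 1"] False j1
    have "t1 * real (dlev a b (j - 1)) \<le> real (c' (j - 1))" by simp
    moreover have "j - 1 \<noteq> j" using j1 by simp
    ultimately show ?thesis by (simp add: c'_def)
  qed simp
  have t1le: "t1 \<le> 1"
  proof -
    have "t1 * real (dlev a b j) \<le> real (c' j)" using t01 by (simp add: c'_def d_def)
    from ls_seq_down[OF a1 ls'[folded c'_def] _ j1 this]
    have "t1 * real a \<le> real (c' 1)" by (simp add: dlev_def)
    also have "\<dots> \<le> 1 * real a" using ls' by (simp add: ls_seq_def c'_def)
    finally show ?thesis using a1 by (simp add: mult_le_cancel_right)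
  qed
  have h_hh: "h t = hh t" if "t \<in> {0..1}" for t using pi[OF that] by (simp add: h_def hh_def)
  have mid: "hh t = m + (t * d - real (c j))" if "t0 \<le> t" "t \<le> t1" for t
  proof -
    have "t * real (dlev a b (j - 1)) \<le> t1 * real (dlev a b (j - 1))"
      using that by (intro mult_right_mono) auto
    then have "j - 1 = 0 \<or> t * real (dlev a b (j - 1)) \<le> real (c (j - 1))"
      using prev by auto
    moreover have "real (c (Suc (j - 1))) \<le> t * real (dlev a b (Suc (j - 1)))"
      using that(1) j1 dpos t01 mult_right_mono[OF that(1), of d] by (simp add: d_def)
    ultimately show ?thesis
      using height_ascending[OF a1 ls ij, of "j - 1" K t] j1 jK
      by (auto simp: hh_def m_def d_def)
  qed
  \<comment> \<open>All later minima are integers strictly above \<open>m\<close>, hence at least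
    \<open>m + 1\<close>; the other case is the continuation of piece \<open>j - 1\<close>
    itself.\<close>
  have late: "m + 1 \<le> hh t" if t: "t1 \<le> t" for t
  proof -
    have tpos: "0 \<le> t" using t t0lt by simp
    obtain q where q: "q \<le> K" "real (c (Suc q)) \<le> t * real (dlev a b (Suc q))"
      "q = 0 \<or> t * real (dlev a b q) \<le> real (c q)"
      and qmin: "\<And>s. real (c (Suc s)) \<le> t * real (dlev a b (Suc s)) \<Longrightarrow> q \<le> s"
      using segment_exists[where b = b, OF a1 _ tpos, of c K] cK by (metis le_SucI order_refl)
    have tdj: "real (c j) + 1 \<le> t * d" using mult_right_mono[OF t, of d] dpos t01 by simp
    have "q \<le> j - 1" using qmin[of "j - 1"] j1 tdj by (simp add: d_def)
    then have qj: "q < j" using j1 by simp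
    show ?thesis
    proof (cases "even (q + j)")
      case False
      have "hh t = - real_of_int (dip K c j (Suc q)) + (t * real (dlev a b (Suc q)) - real (c (Suc q)))"
        unfolding hh_def using height_ascending[OF a1 ls ij _ False q(3,2)] qj jK by simp
      moreover have "m + 1 \<le> - real_of_int (dip K c j (Suc q))" if "Suc q < j"
        using after[of "Suc q"] that False by (simp add: m_def)
      ultimately show ?thesis using q(2) tdj qj
        by (cases "Suc q = j") (auto simp: m_def d_def)
    next
      case True
      show ?thesis
      proof (cases "q = 0")
        case False
        then have "hh t = - real_of_int (dip K c j q) + (real (c q) - t * real (dlev a b q))"
          unfolding hh_def using height_descending[OF a1 ls ij q(1) _ True _ q(2)] q(3) by auto
        then show ?thesis using after[of q] False qj True q(3) by (simp add: m_def)
      next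
        case q0: True
        then have ev: "even j" using True by simp
        then have i1: "i = 1" using ij by (simp add: mod2_eq_if)
        have j2: "2 \<le> j" using ev j1 by (cases "j = 1") auto
        have "hh t \<ge> - real_of_int (dip K c j 2) + (real (c 1) / real a * real (dlev a b 2) - real (c 2))"
          unfolding hh_def i1
        proof (rule height_fundamental[OF a1 ls _ _ tpos])
          show "1 = Suc j mod 2" using ij i1 by simp
          show "2 \<le> K" using j2 jK by simp
          show "real (c 1) \<le> t * real a" using q(2) q0 by (simp add: dlev_def)
        qed
        \<comment> \<open>For \<open>j = 2\<close> the missing unit comes from
          \<open>c' 2 = c 2 + 1\<close>; for larger \<open>j\<close> one has
          \<open>c' 2 = c 2\<close>, and the unit comes from the strict inequality
          \<open>after\<close> at index 2.\<close>
        moreover have ge: "real (c 1) / real a * real (dlev a b 2) \<ge> real (c' 2)"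
        proof -
          have "real (c' 1) \<le> real (c' 1) / real a * real (dlev a b 1)" using a1 by (simp add: dlev_def)
          from ls_seq_up[OF a1 ls'[folded c'_def] _ _ this, of 2] j2
          show ?thesis by (simp add: c'_def)
        qed
        ultimately show ?thesis using after[of 2] j2 ev
          by (cases "j = 2") (auto simp: m_def c'_def)
      qed
    qed
  qed
  have low: "m \<le> hh t" if tpos: "0 \<le> t" for t
  proof (cases "t0 \<le> t")
    case True
    show ?thesis
    proof (cases "t \<le> t1")
      case le: True
      have "real (c j) \<le> t * d" using mult_right_mono[OF True, of d] dpos t01 by simp
      then show ?thesis using mid[OF True le] by simp
    next
      case False
      then show ?thesis using late[of t] by simp
    qed
  next
    case False
    obtain q where q: "q \<le> K" "real (c (Suc q)) \<le> t * real (dlev a b (Suc q))"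
      "q = 0 \<or> t * real (dlev a b q) \<le> real (c q)"
      using segment_exists[where b = b, OF a1 _ tpos, of c K] cK by (metis le_SucI order_refl)
    have qj: "j \<le> q"
    proof (rule ccontr)
      assume "\<not> j \<le> q"
      then have "real (c j) \<le> t * real (dlev a b j)"
        using ls_seq_up[OF a1 ls _ _ q(2), of j] by simp
      moreover have "t * d < t0 * d" using False dpos by simp
      ultimately show False using t01 by (simp add: d_def)
    qed
    show ?thesis
    proof (cases "even (q + j)")
      case True
      have "hh t = - real_of_int (dip K c j q) + (real (c q) - t * real (dlev a b q))"
        unfolding hh_def using height_descending[OF a1 ls ij q(1) _ True _ q(2)] q(3) qj j1 by auto
      moreover have "dip K c j q \<le> dip K c j j"
        using before[of q] True qj by (cases "q = j") auto
      ultimately show ?thesis using q(3) qj j1 by (auto simp: m_def)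
    next
      case odd: False
      show ?thesis
      proof (cases "q = K")
        case True
        \<comment> \<open>Since \<open>c K = 0\<close>, piece \<open>K\<close> shrinks to t = 0. The
          starting value 0 is then treated as the dip of index \<open>Suc K\<close>, to which
          \<open>before\<close> applies.\<close>
        have "dip K c j (Suc K) = 0" using cK by (simp add: dip_def alt_tail_def)
        moreover have "dip K c j (Suc K) \<le> dip K c j j" using before[of "Suc K"] True odd qj by simp
        moreover have "c K = 0" using cK by simp
        then have "t = 0" using q(3) True dlev_pos[OF a1, of K b] jK tpos
          by (auto simp: mult_le_0_iff)
        then have "hh t = 0" by (simp add: hh_def coroot_level_path[OF ij])
        ultimately show ?thesis by (simp add: m_def)
      next
        case False
        have "hh t = - real_of_int (dip K c j (Suc q)) + (t * real (dlev a b (Suc q)) - real (c (Suc q)))"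
          unfolding hh_def using height_ascending[OF a1 ls ij _ odd q(3,2)] False q(1) by simp
        moreover have "dip K c j (Suc q) \<le> dip K c j j" using before[of "Suc q"] qj odd by simp
        ultimately show ?thesis using q(2) by (simp add: m_def)
      qed
    qed
  qed
  have ht0: "hh t0 = m" using mid[of t0] t0lt t01 by simp
  have ht1: "hh t1 = m + 1" using mid[of t1] t0lt t01 by simp
  have inf: "Inf (h ` {0..1}) = m"
    by (rule cInf_eq_minimum) (use ht0 h_hh t0lt t1le low in \<open>force simp: image_iff\<close>)+
  have strict: "m < hh t" if "t0 < t" for t
  proof (cases "t \<le> t1")
    case True
    have "t0 * d < t * d" using that dpos by simp
    then show ?thesis using mid[of t] that True t01 by simp
  next
    case False
    then show ?thesis using late[of t] by simp
  qed
  have sup: "Sup {t \<in> {0..1}. h t = m} = t0"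
  proof (rule cSup_eq_maximum)
    show "t0 \<in> {t \<in> {0..1}. h t = m}" using ht0 h_hh t0lt t1le by auto
    show "\<And>x. x \<in> {t \<in> {0..1}. h t = m} \<Longrightarrow> x \<le> t0" using strict h_hh by force
  qed
  have inf1: "Inf {t \<in> {t0..1}. h t = m + 1} = t1"
  proof (rule cInf_eq_minimum)
    show "t1 \<in> {t \<in> {t0..1}. h t = m + 1}" using ht1 h_hh t0lt t1le by auto
    fix x assume x: "x \<in> {t \<in> {t0..1}. h t = m + 1}"
    show "t1 \<le> x"
    proof (rule ccontr)
      assume "\<not> t1 \<le> x"
      then have "x * d < t1 * d" "hh x = m + (x * d - real (c j))" using mid[of x] x dpos by auto
      then show False using x h_hh[of x] t01 t0lt by auto
    qed
  qed
  have h1: "\<not> h 1 - m < 1" using late[OF t1le] h_hh[of 1] by simp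
  define \<pi>' where "\<pi>' = (\<lambda>t. if t \<le> t0 then \<pi> t
                 else if t \<le> t1 then \<pi> t0 + sref i (\<pi> t - \<pi> t0)
                 else \<pi> t - alpha i)"
  have i2: "\<not> i > 1" using ij by simp
  have fp: "fp i \<pi> = Some \<pi>'"
    using i2 h1
    unfolding fp_def \<pi>'_def Let_def h_def[symmetric] inf sup inf1 by simp
  \<comment> \<open>Only the summand of index \<open>j\<close> changes. The difference of the two
    minima is 0 up to \<open>t0\<close>, then \<open>t * d - c j\<close>, and finally 1 from
    \<open>t1\<close> on: these are the three branches of the root operator.\<close>
  have diff: "level_path a b K c' t = level_path a b K c t
      - (min (t * d) (real (c j) + 1) - min (t * d) (real (c j))) *\<^sub>R alpha i" for t
  proof -
    have jin: "j \<in> {1..K}" using j1 jK by simp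
    have "(\<Sum>p = 1..K. min (t * real (dlev a b p)) (real (c' p)) *\<^sub>R alpha (Suc p mod 2))
       = (\<Sum>p = 1..K. min (t * real (dlev a b p)) (real (c p)) *\<^sub>R alpha (Suc p mod 2))
       + (min (t * d) (real (c j) + 1) - min (t * d) (real (c j))) *\<^sub>R alpha i"
      using jin by (simp add: sum.remove[of _ j] c'_def d_def ij algebra_simps cong: sum.cong_simp)
    then show ?thesis unfolding level_path_def by simp
  qed
  have "\<pi>' t = level_path a b K c' t" if t: "t \<in> {0..1}" for t
  proof -
    consider "t \<le> t0" | "t0 < t" "t \<le> t1" | "t1 < t" by linarith
    then show ?thesis
    proof cases
      case 1
      then have "t * d \<le> real (c j)" using mult_right_mono[of t t0 d] dpos t01 by simp
      then show ?thesis using 1 t by (simp add: \<pi>'_def diff pi min_def)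
    next
      case 2
      have p0: "\<pi> t0 = level_path a b K c t0" using pi t0lt t1le by simp
      have "real (c j) \<le> t * d" "t * d \<le> real (c j) + 1"
        using mult_right_mono[of t0 t d] mult_right_mono[of t t1 d] 2 dpos t01 by simp_all
      moreover have "coroot i (\<pi> t - \<pi> t0) = t * d - real (c j)"
        using mid[of t] 2 ht0 pi[OF t] p0 by (simp add: coroot_simps hh_def)
      ultimately show ?thesis using 2 pi[OF t]
        by (simp add: \<pi>'_def diff sref_def min_def)
    next
      case 3
      then have "real (c j) + 1 \<le> t * d" using mult_right_mono[of t1 t d] dpos t01 by simp
      then show ?thesis using 3 t0lt pi[OF t] by (simp add: \<pi>'_def diff min_def)
    qed
  qed
  with fp show thesis using that[of \<pi>'] by (simp add: c'_def)
qed

section \<open>Signatures\<close>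

lemma above_trans: "above P Q \<Longrightarrow> above Q R \<Longrightarrow> above P R"
  by (auto simp: above_def)

lemma above_irrefl: "\<not> above P P"
  by (simp add: above_def)

lemma above_asym: "above P Q \<Longrightarrow> \<not> above Q P"
  by (auto simp: above_def)

definition excess :: "node set \<Rightarrow> node set \<Rightarrow> node set \<Rightarrow> int" where
  "excess R A X = int (card (R \<inter> X)) - int (card (A \<inter> X))"

lemma excess_Un:
  assumes "finite R" "finite A" "X \<inter> Y = {}"
  shows "excess R A (X \<union> Y) = excess R A X + excess R A Y"
proof -
  have "card (S \<inter> (X \<union> Y)) = card (S \<inter> X) + card (S \<inter> Y)" if "finite S" for S
    unfolding Int_Un_distrib using that assms(3) by (intro card_Un_disjoint) auto
  then show ?thesis using assms by (simp add: excess_def)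
qed

lemma excess_addable: "n \<in> A \<Longrightarrow> A \<inter> R = {} \<Longrightarrow> excess R A {n} = -1"
proof -
  assume "n \<in> A" "A \<inter> R = {}"
  then have "A \<inter> {n} = {n}" "R \<inter> {n} = {}" by auto
  then show ?thesis by (simp add: excess_def)
qed

lemma excess_removable: "n \<in> R \<Longrightarrow> A \<inter> R = {} \<Longrightarrow> excess R A {n} = 1"
proof -
  assume "n \<in> R" "A \<inter> R = {}"
  then have "R \<inter> {n} = {n}" "A \<inter> {n} = {}" by auto
  then show ?thesis by (simp add: excess_def)
qed

text \<open>Reading the signature from the top with removable nodes counted \<open>+1\<close> and addable nodes
\<open>-1\<close>, the cogood node is the step that follows the last maximum of the partial sums.\<close>
locale signature =
  fixes A R :: "node set"
  assumes fin: "finite A" "finite R" and disj: "A \<inter> R = {}"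
    and total: "\<And>C D. C \<in> A \<union> R \<Longrightarrow> D \<in> A \<union> R \<Longrightarrow> C \<noteq> D \<Longrightarrow> above C D \<or> above D C"
begin

abbreviation "W \<equiv> excess R A"

definition survives :: "node \<Rightarrow> bool" where
  "survives B \<longleftrightarrow> B \<in> A \<and> (\<forall>C \<in> A \<union> R. above B C \<longrightarrow>
     card {D \<in> R. above B D \<and> \<not> above C D} \<le> card {D \<in> A. above B D \<and> \<not> above C D})"

text \<open>An initial segment of the signature, given as a set of nodes rather than by a
  position.\<close>

definition prefix :: "node set \<Rightarrow> bool" where
  "prefix X \<longleftrightarrow> X \<subseteq> A \<union> R \<and> (\<forall>D \<in> X. \<forall>C \<in> A \<union> R. above C D \<longrightarrow> C \<in> X)"

lemma exists_bottom:
  assumes "Z \<subseteq> A \<union> R" "Z \<noteq> {}"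
  obtains C where "C \<in> Z" "\<And>D. D \<in> Z \<Longrightarrow> D = C \<or> above D C"
proof -
  have "finite Z" using assms fin finite_subset by blast
  then have "\<exists>C\<in>Z. \<forall>D\<in>Z. D = C \<or> above D C" using assms(2,1)
  proof (induction Z rule: finite_ne_induct)
    case (insert x F)
    then obtain C where C: "C \<in> F" "\<forall>D\<in>F. D = C \<or> above D C" by auto
    then have "above x C \<or> above C x" using total[of x C] insert by auto
    then show ?case
    proof
      assume "above x C"
      then show ?thesis using C by auto
    next
      assume "above C x"
      then have "\<forall>D\<in>insert x F. D = x \<or> above D x" using C(2) above_trans[of _ C x] by auto
      then show ?thesis by (rule bexI) simp
    qed
  qed auto
  then show ?thesis using that by blast
qed

lemma exists_top:
  assumes "Z \<subseteq> A \<union> R" "Z \<noteq> {}"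
  obtains C where "C \<in> Z" "\<And>D. D \<in> Z \<Longrightarrow> D = C \<or> above C D"
proof -
  have "finite Z" using assms fin finite_subset by blast
  then have "\<exists>C\<in>Z. \<forall>D\<in>Z. D = C \<or> above C D" using assms(2,1)
  proof (induction Z rule: finite_ne_induct)
    case (insert x F)
    then obtain C where C: "C \<in> F" "\<forall>D\<in>F. D = C \<or> above C D" by auto
    then have "above x C \<or> above C x" using total[of x C] insert by auto
    then show ?case
    proof
      assume "above C x"
      then show ?thesis using C by auto
    next
      assume "above x C"
      then have "\<forall>D\<in>insert x F. D = x \<or> above x D" using C(2) above_trans[of x C] by auto
      then show ?thesis by (rule bexI) simp
    qed
  qed auto
  then show ?thesis using that by blast
qed

lemma survives_excess:
  "survives B \<longleftrightarrow> B \<in> A \<and> (\<forall>C \<in> A \<union> R. above B C \<longrightarrow>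
     W {D \<in> A \<union> R. above B D \<and> \<not> above C D} \<le> 0)"
proof -
  have "R \<inter> {D \<in> A \<union> R. above B D \<and> \<not> above C D} = {D \<in> R. above B D \<and> \<not> above C D}"
    "A \<inter> {D \<in> A \<union> R. above B D \<and> \<not> above C D} = {D \<in> A. above B D \<and> \<not> above C D}" for C
    by auto
  then show ?thesis unfolding survives_def excess_def by auto
qed

text \<open>Such a prefix consists of the nodes above \<open>n\<close>, the node \<open>n\<close>
  counting -1, and a stretch below \<open>n\<close>. If the stretch is nonempty, survival of
  \<open>n\<close>, tested at its lowest node, says that it contributes at most 0.\<close>

lemma excess_after_survivor:
  assumes "survives n" "prefix X" "n \<in> X"
  shows "W X < W {D \<in> A \<union> R. above D n}"
proof -
  define U where "U = {D \<in> A \<union> R. above D n}"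
  define Z where "Z = {D \<in> X. above n D}"
  have nA: "n \<in> A" using assms(1) by (simp add: survives_def)
  have X: "X = (U \<union> {n}) \<union> Z"
    using assms(2,3) total nA unfolding U_def Z_def prefix_def by blast
  have "U \<inter> {n} = {}" "(U \<union> {n}) \<inter> Z = {}"
    unfolding U_def Z_def using above_irrefl above_asym by blast+
  then have "W X = W U - 1 + W Z"
    unfolding X using excess_addable[OF nA disj] by (simp only: excess_Un[OF fin(2,1)])
  moreover have "W Z \<le> 0"
  proof (cases "Z = {}")
    case True then show ?thesis by (simp add: excess_def)
  next
    case False
    have "Z \<subseteq> A \<union> R" using assms(2) by (auto simp: Z_def prefix_def)
    then obtain C where C: "C \<in> Z" "\<And>D. D \<in> Z \<Longrightarrow> D = C \<or> above D C"
      using exists_bottom False by metis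
    have "Z = {D \<in> A \<union> R. above n D \<and> \<not> above C D}"
    proof (intro set_eqI iffI)
      fix D assume "D \<in> Z"
      then show "D \<in> {D \<in> A \<union> R. above n D \<and> \<not> above C D}"
        using C(2)[of D] assms(2) above_irrefl above_asym unfolding Z_def prefix_def by blast
    next
      fix D assume "D \<in> {D \<in> A \<union> R. above n D \<and> \<not> above C D}"
      then show "D \<in> Z" using C(1) total[of C D] assms(2) by (auto simp: Z_def prefix_def)
    qed
    moreover have "C \<in> A \<union> R" "above n C" using C(1) assms(2) by (auto simp: Z_def prefix_def)
    ultimately show ?thesis using assms(1) by (simp add: survives_excess)
  qed
  ultimately show ?thesis by (simp add: U_def)
qed

text \<open>Suppose the bound fails. Among the prefixes avoiding \<open>n\<close>, take one of
  maximal excess and, among those, of maximal size; call it \<open>T\<close>. The node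
  \<open>B\<close> following \<open>T\<close> lies above \<open>n\<close>, is addable because the
  excess must drop, and survives because every longer prefix has smaller excess. This contradicts
  the choice of \<open>n\<close> as the first survivor.\<close>

lemma excess_before_first_survivor:
  assumes sn: "survives n" and first: "\<And>B. survives B \<Longrightarrow> B = n \<or> above n B"
    and pX: "prefix X" and nX: "n \<notin> X"
  shows "W X \<le> W {D \<in> A \<union> R. above D n}"
proof (rule ccontr)
  define U where "U = {D \<in> A \<union> R. above D n}"
  assume "\<not> ?thesis"
  then have gt: "W U < W X" by (simp add: U_def)
  define F where "F = {X. prefix X \<and> n \<notin> X}"
  have nA: "n \<in> A" using sn by (simp add: survives_def)
  have finF: "finite F" by (rule finite_subset[of _ "Pow (A \<union> R)"]) (use fin in \<open>auto simp: F_def prefix_def\<close>)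
  have FU: "X \<subseteq> U" if "X \<in> F" for X
  proof
    fix D assume "D \<in> X"
    then show "D \<in> U" using that total[of D n] nA by (auto simp: F_def U_def prefix_def)
  qed
  define w0 where "w0 = Max (W ` F)"
  have "W ` F \<noteq> {}" using pX nX by (auto simp: F_def)
  then have "w0 \<in> W ` F" using finF unfolding w0_def by (intro Max_in) auto
  define G where "G = {X \<in> F. W X = w0}"
  have Gne: "G \<noteq> {}" using \<open>w0 \<in> W ` F\<close> by (auto simp: G_def)
  have finG: "finite G" using finF by (simp add: G_def)
  have "Max (card ` G) \<in> card ` G" using Gne finG by (intro Max_in) auto
  then obtain T where T: "T \<in> G" "card T = Max (card ` G)" by force
  have TF: "T \<in> F" and Tw: "W T = w0" using T(1) by (auto simp: G_def)
  have max: "W Y \<le> W T" if "Y \<in> F" for Y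
    using Max_ge[of "W ` F" "W Y"] finF that Tw by (simp add: w0_def)
  have big: "W Y < W T" if "Y \<in> F" "card T < card Y" for Y
  proof (rule ccontr)
    assume "\<not> W Y < W T"
    then have "Y \<in> G" using max[OF that(1)] that(1) Tw by (auto simp: G_def)
    then have "card Y \<le> Max (card ` G)" using finG by simp
    then show False using that(2) T(2) by simp
  qed
  have gtT: "W U < W T" using gt max[of X] pX nX by (simp add: F_def)
  have "U - T \<noteq> {}" using FU[OF TF] gtT by auto
  then obtain B where B: "B \<in> U - T" "\<And>D. D \<in> U - T \<Longrightarrow> D = B \<or> above B D"
    using exists_top[of "U - T"] by (auto simp: U_def)
  have TS: "T \<subseteq> A \<union> R" "finite T" using TF fin finite_subset by (auto simp: F_def prefix_def)
  have BT: "D \<in> T" if "D \<in> A \<union> R" "above D B" for D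
  proof (rule ccontr)
    assume "D \<notin> T"
    moreover have "D \<in> U" using that B(1) above_trans by (auto simp: U_def)
    ultimately show False using B(2)[of D] that above_irrefl above_asym by auto
  qed
  have TB: "insert B T \<in> F"
    using TF B(1) BT by (auto simp: F_def prefix_def U_def above_irrefl)
  have wTB: "W (insert B T) = W T + W {B}"
    using excess_Un[OF fin(2,1), of T "{B}"] B(1) by simp
  have "W (insert B T) < W T" using big[OF TB] B(1) TS by simp
  then have "B \<notin> R" using wTB excess_removable[OF _ disj, of B] by auto
  then have BA: "B \<in> A" using B(1) by (auto simp: U_def)
  have "survives B"
    unfolding survives_excess
  proof (intro conjI BA ballI impI)
    fix C assume C: "C \<in> A \<union> R" "above B C"
    define Y where "Y = {D \<in> A \<union> R. \<not> above C D}"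
    define Z where "Z = {D \<in> A \<union> R. above B D \<and> \<not> above C D}"
    have BC: "\<not> above C B" using C(2) above_asym by blast
    have TaboveB: "above D B" if "D \<in> T" for D
    proof -
      have "D \<noteq> B" using that B(1) by auto
      moreover have "\<not> above B D" using that TF B(1) by (auto simp: F_def prefix_def U_def)
      ultimately show ?thesis using total[of D B] that TS BA by auto
    qed
    have Y: "Y = insert B T \<union> Z"
    proof (intro set_eqI iffI)
      fix D assume D: "D \<in> Y"
      then have "D = B \<or> above D B \<or> above B D" using total[of D B] BA by (auto simp: Y_def)
      then show "D \<in> insert B T \<union> Z" using D BT unfolding Y_def Z_def by blast
    next
      fix D assume "D \<in> insert B T \<union> Z"
      then show "D \<in> Y" using BC TaboveB C(2) TS BA above_trans above_irrefl
        unfolding Y_def Z_def by (smt (verit) Un_iff insert_iff mem_Collect_eq subsetD)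
    qed
    have dis: "insert B T \<inter> Z = {}" 
      using TaboveB above_asym above_irrefl unfolding Z_def by blast
    have wY: "W Y = W T - 1 + W Z"
      unfolding Y using excess_Un[OF fin(2,1) dis] wTB excess_addable[OF BA disj] by simp
    have pY: "prefix Y" using above_trans unfolding Y_def prefix_def by blast
    \<comment> \<open>As \<open>W Y = W T - 1 + W Z\<close> with integer values, this is exactly
      \<open>W Z \<le> 0\<close>. Prefixes reaching \<open>n\<close> are handled by the preceding
      lemma, the others by the extremal choice of \<open>T\<close>.\<close>
    have "W Y < W T"
    proof (cases "n \<in> Y")
      case True
      then show ?thesis using excess_after_survivor[OF sn pY] gtT by (simp add: U_def)
    next
      case False
      have "finite Y" using fin by (simp add: Y_def)
      then have "card T < card Y" using B(1) Y by (intro psubset_card_mono) auto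
      then show ?thesis using big[of Y] pY False by (simp add: F_def)
    qed
    then show "W {D \<in> A \<union> R. above B D \<and> \<not> above C D} \<le> 0" using wY by (simp add: Z_def)
  qed
  then have "B = n \<or> above n B" by (rule first)
  then show False using B(1) above_asym above_irrefl by (auto simp: U_def)
qed

end

section \<open>Levels of nodes and the standard path\<close>

definition level :: "nat \<Rightarrow> node \<Rightarrow> nat" where
  "level a n = fst (snd n) + snd (snd n) + (if fst n < a then 0 else 1) - 1"

definition level_count :: "nat \<Rightarrow> mpart \<Rightarrow> nat \<Rightarrow> nat" where
  "level_count a lam j = card {n \<in> ydiag lam. level a n = j}"

definition level_nodes :: "nat \<Rightarrow> nat \<Rightarrow> nat \<Rightarrow> node set" where
  "level_nodes a b j = {(k, x, y). k < a + b \<and> 1 \<le> x \<and> 1 \<le> y \<and> level a (k, x, y) = j}"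

lemma res_level: "1 \<le> x \<Longrightarrow> res a k x y = Suc (level a (k, x, y)) mod 2"
proof -
  assume "1 \<le> x"
  then have l: "Suc (level a (k, x, y)) = x + y + (if k < a then 0 else 1)" by (simp add: level_def)
  have "(int y - int x + (if k < a then 0 else 1)) mod 2
      = (int y - int x + (if k < a then 0 else 1) + int x * 2) mod 2"
    by (rule mod_mult_self1[symmetric])
  also have "\<dots> = int ((x + y + (if k < a then 0 else 1)) mod 2)"
    by (simp add: zmod_int algebra_simps)
  finally have "(int y - int x + (if k < a then 0 else 1)) mod 2 = int ((x + y + (if k < a then 0 else 1)) mod 2)" .
  then show ?thesis unfolding res_def l by simp
qed

section \<open>Staircases, and the coefficients c_j and d_j as level counts\<close>

lemma length_stair [simp]: "length (stair n) = n"
  by (simp add: stair_def)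

lemma nth_stair: "i < n \<Longrightarrow> stair n ! i = n - i"
  by (simp add: stair_def rev_nth del: upt_Suc)

lemma part_Yst:
  assumes "k < a + b"
  shows "part (Yst a b j) k x = (if 1 \<le> x then (if k < a then Suc j else j) - x else 0)"
  using assms by (auto simp: part_def Yst_def nth_append nth_stair)

text \<open>The extra 1 in the level of 1-corner nodes matches the shorter staircases there, so that
  the difference of consecutive staircase multipartitions is precisely one level.\<close>

lemma ydiag_Yst:
  "ydiag (Yst a b j) = {(k, x, y). k < a + b \<and> 1 \<le> x \<and> 1 \<le> y \<and> level a (k, x, y) \<le> j}"
proof -
  have "length (Yst a b j) = a + b" by (simp add: Yst_def)
  then show ?thesis unfolding ydiag_def by (auto simp: part_Yst level_def split: if_splits)
qed

lemma ydiag_Yst_0: "ydiag (Yst a b 0) = {}"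
  by (auto simp: ydiag_Yst level_def)

lemma ydiag_Yst_Suc: "ydiag (Yst a b (Suc j)) = ydiag (Yst a b j) \<union> level_nodes a b (Suc j)"
  by (auto simp: ydiag_Yst level_nodes_def)

lemma ydiag_Yst_disjoint: "ydiag (Yst a b j) \<inter> level_nodes a b (Suc j) = {}"
  by (auto simp: ydiag_Yst level_nodes_def)

lemma
  assumes "1 \<le> j"
  shows finite_level_nodes: "finite (level_nodes a b j)"
    and card_level_nodes: "card (level_nodes a b j) = dlev a b j"
proof -
  define s where "s = (\<lambda>k. if k < a then 0 else (1::nat))"
  \<comment> \<open>Component and row determine a node of given level, so counting reduces to rows:
    \<open>j\<close> of them in a 0-corner component and \<open>j - 1\<close> in a 1-corner
    one.\<close>
  define f where "f = (\<lambda>(k, x). (k, x, Suc j - x - s k))"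
  define S where "S = (SIGMA k:{..<a + b}. {1..j - s k})"
  have eq: "level_nodes a b j = f ` S"
  proof (intro set_eqI iffI)
    fix n assume "n \<in> level_nodes a b j"
    then obtain k x y where n: "n = (k, x, y)" "k < a + b" "1 \<le> x" "1 \<le> y" "x + y + s k - 1 = j"
      by (auto simp: level_nodes_def level_def s_def)
    have "(k, x) \<in> S" "n = f (k, x)" using n by (auto simp: f_def S_def)
    then show "n \<in> f ` S" by blast
  next
    fix n assume "n \<in> f ` S"
    then show "n \<in> level_nodes a b j" using assms
      by (auto simp: level_nodes_def level_def f_def S_def s_def split: if_splits)
  qed
  have fS: "finite S" by (simp add: S_def)
  show "finite (level_nodes a b j)" unfolding eq using fS by simp
  have "card (level_nodes a b j) = card S"
    unfolding eq by (rule card_image) (auto simp: inj_on_def f_def)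
  also have "\<dots> = (\<Sum>k<a + b. j - s k)" by (simp add: S_def)
  also have "\<dots> = (\<Sum>k\<in>{..<a}. j - s k) + (\<Sum>k\<in>{a..<a + b}. j - s k)"
    by (subst sum.union_disjoint[symmetric]) (auto intro: sum.cong)
  also have "(\<Sum>k\<in>{..<a}. j - s k) = (\<Sum>k\<in>{..<a}. j)" by (rule sum.cong) (auto simp: s_def)
  also have "(\<Sum>k\<in>{a..<a + b}. j - s k) = (\<Sum>k\<in>{a..<a + b}. j - 1)" by (rule sum.cong) (auto simp: s_def)
  finally show "card (level_nodes a b j) = dlev a b j" by (simp add: dlev_def)
qed

lemma finite_ydiag_Yst: "finite (ydiag (Yst a b j))"
  by (induction j) (simp_all add: ydiag_Yst_0 ydiag_Yst_Suc finite_level_nodes)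

lemma dcoef_eq: "1 \<le> j \<Longrightarrow> dcoef a b j = dlev a b j"
  using ydiag_Yst_Suc[of a b "j - 1"] ydiag_Yst_disjoint[of a b "j - 1"] card_level_nodes[of j a b]
  by (simp add: dcoef_def Un_Diff Diff_triv Int_commute)

lemma ccoef_eq:
  assumes "1 \<le> j" "length lam = a + b"
  shows "ccoef a b lam j = level_count a lam j"
proof -
  have "ydiag (Yst a b j) - ydiag (Yst a b (j - 1)) = level_nodes a b j"
    using ydiag_Yst_Suc[of a b "j - 1"] ydiag_Yst_disjoint[of a b "j - 1"] assms(1)
    by (simp add: Un_Diff Diff_triv Int_commute)
  moreover have "level_nodes a b j \<inter> ydiag lam = {n \<in> ydiag lam. level a n = j}"
    using assms(2) by (auto simp: level_nodes_def ydiag_def)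
  ultimately show ?thesis by (simp add: ccoef_def level_count_def)
qed

lemma psi_0: "psi a b 0 = Lam a b"
  by (simp add: psi_def weight_def ydiag_Yst_0)

text \<open>All nodes of one level share their residue, so passing to the next staircase subtracts a
  multiple of a single simple root.\<close>

lemma psi_Suc: "psi a b (Suc j) = psi a b j - real (dlev a b (Suc j)) *\<^sub>R alpha (Suc (Suc j) mod 2)"
proof -
  define m where "m = Suc (Suc j) mod 2"
  have card_res: "card {n \<in> ydiag (Yst a b (Suc j)). nres a n = i}
      = card {n \<in> ydiag (Yst a b j). nres a n = i} + (if i = m then dlev a b (Suc j) else 0)" for i
  proof -
    have r: "nres a n = m" if "n \<in> level_nodes a b (Suc j)" for n
      using that unfolding m_def by (auto simp: level_nodes_def nres_def res_level)
    have "{n \<in> ydiag (Yst a b (Suc j)). nres a n = i} =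
      {n \<in> ydiag (Yst a b j). nres a n = i} \<union> {n \<in> level_nodes a b (Suc j). nres a n = i}"
      unfolding ydiag_Yst_Suc by blast
    then have "card {n \<in> ydiag (Yst a b (Suc j)). nres a n = i} =
      card ({n \<in> ydiag (Yst a b j). nres a n = i} \<union> {n \<in> level_nodes a b (Suc j). nres a n = i})"
      by simp
    also have "\<dots> = card {n \<in> ydiag (Yst a b j). nres a n = i} + card {n \<in> level_nodes a b (Suc j). nres a n = i}"
      using ydiag_Yst_disjoint[of a b j] finite_ydiag_Yst[of a b j] finite_level_nodes[of "Suc j" a b]
      by (intro card_Un_disjoint) (simp, simp, blast)
    also have "{n \<in> level_nodes a b (Suc j). nres a n = i} = (if i = m then level_nodes a b (Suc j) else {})"
      using r by auto
    finally show ?thesis using card_level_nodes[of "Suc j" a b] by simp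
  qed
  have "m = 0 \<or> m = 1" by (auto simp: m_def)
  then show ?thesis unfolding psi_def weight_def card_res m_def[symmetric]
    by (elim disjE) (simp_all add: algebra_simps)
qed

section \<open>Monotone breakpoints and Abel summation of the standard path\<close>

lemma abel_sum:
  fixes f :: "nat \<Rightarrow> real" and v :: "nat \<Rightarrow> 'a::real_vector"
  shows "(\<Sum>j = 0..N. (f j - f (Suc j)) *\<^sub>R v j)
     = f 0 *\<^sub>R v 0 + (\<Sum>j = 1..N. f j *\<^sub>R (v j - v (j - 1))) - f (Suc N) *\<^sub>R v N"
  by (induction N) (simp_all add: algebra_simps)

lemma ecoef_antimono:
  assumes a1: "1 \<le> a" and len: "length lam = a + b" and ls: "ls_seq a b (level_count a lam)"
    and "j \<le> N"
  shows "ecoef a b lam N (Suc j) \<le> ecoef a b lam N j"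
proof -
  consider "j = 0" "N = 0" | "j = 0" "1 \<le> N" | "1 \<le> j" "j = N" | "1 \<le> j" "j < N" using assms(4) by linarith
  then show ?thesis
  proof cases
    case 1 then show ?thesis by (simp add: ecoef_def)
  next
    case 2
    then show ?thesis using ls a1 len
      by (simp add: ecoef_def ccoef_eq dcoef_eq ls_seq_def dlev_def divide_le_eq_1)
  next
    case 3 then show ?thesis by (simp add: ecoef_def)
  next
    case 4
    have "level_count a lam (Suc j) * dlev a b j \<le> level_count a lam j * dlev a b (Suc j)"
      using ls 4 by (simp add: ls_seq_def)
    then have "real (level_count a lam (Suc j)) * real (dlev a b j) \<le> real (level_count a lam j) * real (dlev a b (Suc j))"
      by (metis of_nat_le_iff of_nat_mult)
    then show ?thesis using 4 len dlev_pos[OF a1, of j b] dlev_pos[OF a1, of "Suc j" b]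
      by (simp add: ecoef_def ccoef_eq dcoef_eq divide_simps mult_ac)
  qed
qed

text \<open>Because the breakpoints are monotone, the time spent in direction \<open>j\<close>
  before t is a difference of two truncations of t. Summation by parts then leaves only differences
  of consecutive directions, which are multiples of simple roots. Raising the bound from
  \<open>N\<close> to \<open>K\<close> adds zero summands.\<close>

lemma std_path_eq_level_path:
  assumes a1: "1 \<le> a" and len: "length lam = a + b" and ls: "ls_seq a b (level_count a lam)"
    and N: "\<And>p. N < p \<Longrightarrow> level_count a lam p = 0" and NK: "N \<le> K" and t: "0 \<le> t" "t \<le> 1"
  shows "std_path a b lam N t = level_path a b K (level_count a lam) t"
proof -
  define c where "c = level_count a lam"
  define e where "e = ecoef a b lam N"
  have e0: "e 0 = 1" "e (Suc N) = 0" by (simp_all add: e_def ecoef_def)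
  have "std_path a b lam N t = (\<Sum>j = 0..N. (min t (e j) - min t (e (Suc j))) *\<^sub>R psi a b j)"
    unfolding std_path_def e_def
  proof (rule sum.cong[OF refl])
    fix j assume "j \<in> {0..N}"
    then have "ecoef a b lam N (Suc j) \<le> ecoef a b lam N j" using ecoef_antimono[OF a1 len ls] by simp
    then have "max 0 (min t (ecoef a b lam N j) - ecoef a b lam N (Suc j))
      = min t (ecoef a b lam N j) - min t (ecoef a b lam N (Suc j))" by (auto simp: max_def min_def)
    then show "max 0 (min t (ecoef a b lam N j) - ecoef a b lam N (Suc j)) *\<^sub>R psi a b j
      = (min t (ecoef a b lam N j) - min t (ecoef a b lam N (Suc j))) *\<^sub>R psi a b j" by simp
  qed
  also have "\<dots> = t *\<^sub>R Lam a b + (\<Sum>j = 1..N. min t (e j) *\<^sub>R (psi a b j - psi a b (j - 1)))"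
    using abel_sum[of "\<lambda>j. min t (e j)" "psi a b" N] t e0 by (simp add: psi_0)
  also have "(\<Sum>j = 1..N. min t (e j) *\<^sub>R (psi a b j - psi a b (j - 1)))
     = (\<Sum>j = 1..N. - (min (t * real (dlev a b j)) (real (c j)) *\<^sub>R alpha (Suc j mod 2)))"
  proof (rule sum.cong[OF refl])
    fix j assume j: "j \<in> {1..N}"
    then obtain j0 where j0: "j = Suc j0" by (cases j) auto
    have d: "0 < real (dlev a b j)" using dlev_pos[OF a1, of j b] j by simp
    have "e j = real (c j) / real (dlev a b j)"
      using j len by (simp add: e_def ecoef_def c_def ccoef_eq dcoef_eq)
    then have "min t (e j) * real (dlev a b j) = min (t * real (dlev a b j)) (real (c j))"
      using d by (simp add: min_mult_distrib_right)
    then show "min t (e j) *\<^sub>R (psi a b j - psi a b (j - 1)) =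
      - (min (t * real (dlev a b j)) (real (c j)) *\<^sub>R alpha (Suc j mod 2))"
      using psi_Suc[of a b j0] j0 by simp
  qed
  also have "\<dots> = - (\<Sum>j = 1..N. min (t * real (dlev a b j)) (real (c j)) *\<^sub>R alpha (Suc j mod 2))"
    by (rule sum_negf)
  also have "(\<Sum>j = 1..N. min (t * real (dlev a b j)) (real (c j)) *\<^sub>R alpha (Suc j mod 2))
     = (\<Sum>j = 1..K. min (t * real (dlev a b j)) (real (c j)) *\<^sub>R alpha (Suc j mod 2))"
    by (rule sum.mono_neutral_left) (use NK N t in \<open>auto simp: c_def\<close>)
  finally show ?thesis by (simp add: level_path_def c_def)
qed

section \<open>Tight multipartitions\<close>

abbreviation rows :: "mpart \<Rightarrow> nat \<Rightarrow> nat" where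
  "rows lam k \<equiv> length (lam ! k)"

definition wf_mpart :: "nat \<Rightarrow> mpart \<Rightarrow> bool" where
  "wf_mpart r lam \<longleftrightarrow> length lam = r \<and>
     (\<forall>k<r. (\<forall>x. 1 \<le> x \<and> x \<le> rows lam k \<longrightarrow> 0 < part lam k x) \<and>
            (\<forall>x\<ge>1. part lam k (Suc x) \<le> part lam k x))"

text \<open>The length of a component is the last direction of its level-one path and its first part is the
initial direction, so the last condition asks that the level-one paths of consecutive
components concatenate to a standard sequence of directions.\<close>
definition tight :: "nat \<Rightarrow> nat \<Rightarrow> mpart \<Rightarrow> bool" where
  "tight a b lam \<longleftrightarrow> length lam = a + b \<and>
     (\<forall>k<a + b. \<forall>x. 1 \<le> x \<and> x \<le> rows lam k \<longrightarrow> part lam k (Suc x) < part lam k x) \<and>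
     (\<forall>k. Suc k < a + b \<and> lam ! Suc k \<noteq> [] \<longrightarrow>
        part lam (Suc k) 1 + (if Suc k = a then 1 else 0) \<le> rows lam k)"

definition key :: "nat \<Rightarrow> mpart \<Rightarrow> nat \<Rightarrow> nat \<Rightarrow> nat" where
  "key a lam k x = level a (k, x, part lam k x)"

abbreviation charge :: "nat \<Rightarrow> nat \<Rightarrow> nat" where
  "charge a k \<equiv> (if k < a then 0 else 1)"

lemma part_beyond: "rows lam k < x \<Longrightarrow> part lam k x = 0"
  by (simp add: part_def)

lemma key_alt: "1 \<le> x \<Longrightarrow> key a lam k x = part lam k x + (x - 1) + charge a k"
  by (simp add: key_def level_def)

lemma key_bottom: "key a lam k (Suc (rows lam k)) = rows lam k + charge a k"
  by (simp add: key_alt part_beyond)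

text \<open>Going down one row costs at least one column, since parts drop strictly, and this makes
  up for the increase of the row index.\<close>

lemma key_mono:
  assumes "tight a b lam" "k < a + b" "1 \<le> x" "x \<le> x'" "x' \<le> Suc (rows lam k)"
  shows "key a lam k x' \<le> key a lam k x"
  using assms(4,5)
proof (induction x' rule: dec_induct)
  case (step x')
  have "part lam k (Suc x') < part lam k x'"
    using assms(1-3) step unfolding tight_def by simp
  then have "key a lam k (Suc x') \<le> key a lam k x'" using assms(3) step.hyps by (simp add: key_alt)
  then show ?case using step by simp
qed simp

lemma key_ge_bottom:
  assumes "tight a b lam" "k < a + b" "1 \<le> x" "x \<le> Suc (rows lam k)"
  shows "rows lam k + charge a k \<le> key a lam k x"
  using key_mono[OF assms(1-4)] by (simp add: key_bottom)

text \<open>For neighbouring components this is the length condition of \<open>tight\<close>, whose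
  extra 1 at \<open>Suc k = a\<close> absorbs the jump of \<open>charge\<close>. The general case
  chains neighbours: a nonempty component forces the one before it to be nonempty.\<close>

lemma key_top_le_bottom:
  assumes T: "tight a b lam" and "k < k'" "k' < a + b" "lam ! k' \<noteq> []"
  shows "key a lam k' 1 \<le> rows lam k + charge a k"
  using assms(2-4)
proof (induction k' rule: less_induct)
  case (less k')
  then obtain k0 where k0: "k' = Suc k0" "k \<le> k0" by (cases k') auto
  have t: "part lam (Suc k0) 1 + (if Suc k0 = a then 1 else 0) \<le> rows lam k0"
    using T less.prems k0 by (auto simp: tight_def)
  then have le: "key a lam k' 1 \<le> rows lam k0 + charge a k0"
    using k0 by (auto simp: key_alt split: if_splits)
  show ?case
  proof (cases "k = k0")
    case False
    have "1 \<le> rows lam k'" using less.prems(3) by (cases "lam ! k'") auto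
    then have "0 < part lam k' 1" using T less.prems(2) by (fastforce simp: tight_def)
    then have "lam ! k0 \<noteq> []" using t k0 by auto
    then have "key a lam k0 1 \<le> rows lam k + charge a k" using less.IH[of k0] less.prems k0 False by simp
    moreover have "rows lam k0 + charge a k0 \<le> key a lam k0 1"
      using key_ge_bottom[OF T, of k0 1] less.prems k0 by simp
    ultimately show ?thesis using le by simp
  qed (use le in simp)
qed

text \<open>Strictness makes every row end removable and, by the companion lemma
  \<open>addn_tight\<close>, every row extendable, including the first empty one. The two nodes of a
  row have consecutive levels, so the parity of \<open>key\<close> decides which of them carries
  residue \<open>i\<close>.\<close>

lemma remn_tight:
  assumes "tight a b lam"
  shows "remn a lam i = {(k, x, y). k < a + b \<and> 1 \<le> x \<and> x \<le> rows lam k \<and> y = part lam k x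
      \<and> Suc (key a lam k x) mod 2 = i}"
proof -
  have len: "length lam = a + b" using assms by (simp add: tight_def)
  have dec: "part lam k (Suc x) < part lam k x" if "k < a + b" "1 \<le> x" "x \<le> rows lam k" for k x
    using assms that by (simp add: tight_def)
  have "(k < a + b \<and> 1 \<le> x \<and> 1 \<le> y \<and> y = part lam k x \<and> part lam k (Suc x) < y \<and> res a k x y = i)
    \<longleftrightarrow> (k < a + b \<and> 1 \<le> x \<and> x \<le> rows lam k \<and> y = part lam k x \<and> Suc (key a lam k x) mod 2 = i)" for k x y
  proof (cases "x \<le> rows lam k")
    case True
    then show ?thesis using dec[of k x] by (auto simp: key_def res_level)
  next
    case False
    then show ?thesis using part_beyond[of lam k x] by auto
  qed
  then show ?thesis unfolding remn_def len by simp
qed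

lemma addn_tight:
  assumes "tight a b lam"
  shows "addn a lam i = {(k, x, y). k < a + b \<and> 1 \<le> x \<and> x \<le> Suc (rows lam k) \<and> y = Suc (part lam k x)
      \<and> key a lam k x mod 2 = i}"
proof -
  have len: "length lam = a + b" using assms by (simp add: tight_def)
  have lev: "level a (k, x, Suc (part lam k x)) = Suc (key a lam k x)" if "1 \<le> x" for k x
    using that by (simp add: key_def level_def)
  have "(k < a + b \<and> 1 \<le> x \<and> y = Suc (part lam k x) \<and> (x = 1 \<or> y \<le> part lam k (x - 1)) \<and> res a k x y = i)
    \<longleftrightarrow> (k < a + b \<and> 1 \<le> x \<and> x \<le> Suc (rows lam k) \<and> y = Suc (part lam k x) \<and> key a lam k x mod 2 = i)" for k x y
  proof -
    consider "x = 0" | "x = 1" | x0 where "x = Suc x0" "1 \<le> x0" "x0 \<le> rows lam k"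
      | x0 where "x = Suc x0" "1 \<le> x0" "rows lam k < x0"
      by (cases x) force+
    then show ?thesis
    proof cases
      case 3
      then have "k < a + b \<longrightarrow> part lam k x < part lam k (x - 1)" using assms by (simp add: tight_def)
      moreover have "res a k x (Suc (part lam k x)) = key a lam k x mod 2"
        using 3 by (simp add: res_level lev)
      ultimately show ?thesis using 3 by auto
    next
      case 4
      then show ?thesis using part_beyond[of lam k x0] by auto
    qed (auto simp: res_level lev)
  qed
  then show ?thesis unfolding addn_def len by simp
qed

lemma finite_remn: "finite (remn a lam i)"
proof (rule finite_subset)
  show "remn a lam i \<subseteq> (\<lambda>(k, x). (k, x, part lam k x)) ` (SIGMA k:{..<length lam}. {..rows lam k})"
  proof
    fix n assume "n \<in> remn a lam i"
    then obtain k x where n: "n = (k, x, part lam k x)" "k < length lam" "1 \<le> part lam k x"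
      by (auto simp: remn_def)
    then have "x \<le> rows lam k" using part_beyond[of lam k x] by (cases "x \<le> rows lam k") auto
    then show "n \<in> (\<lambda>(k, x). (k, x, part lam k x)) ` (SIGMA k:{..<length lam}. {..rows lam k})"
      using n by force
  qed
qed simp

lemma finite_addn: "finite (addn a lam i)"
proof (rule finite_subset)
  show "addn a lam i \<subseteq> (\<lambda>(k, x). (k, x, Suc (part lam k x))) ` (SIGMA k:{..<length lam}. {..Suc (rows lam k)})"
  proof
    fix n assume "n \<in> addn a lam i"
    then obtain k x where n: "n = (k, x, Suc (part lam k x))" "k < length lam" "1 \<le> x"
      "x = 1 \<or> 1 \<le> part lam k (x - 1)"
      by (auto simp: addn_def)
    then have "x \<le> Suc (rows lam k)"
      using part_beyond[of lam k "x - 1"] by (cases "x - 1 \<le> rows lam k") auto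
    then show "n \<in> (\<lambda>(k, x). (k, x, Suc (part lam k x))) ` (SIGMA k:{..<length lam}. {..Suc (rows lam k)})"
      using n by force
  qed
qed simp

lemma signature_tight:
  assumes T: "tight a b lam"
  shows "signature (addn a lam i) (remn a lam i)"
proof
  show "addn a lam i \<inter> remn a lam i = {}" by (auto simp: addn_def remn_def)
  fix C D assume C: "C \<in> addn a lam i \<union> remn a lam i" and D: "D \<in> addn a lam i \<union> remn a lam i"
    and ne: "C \<noteq> D"
  obtain k x y k' x' y' where CD: "C = (k, x, y)" "D = (k', x', y')" by (metis prod_cases3)
  have "\<not> (k = k' \<and> x = x')"
  proof
    assume eq: "k = k' \<and> x = x'"
    have C': "y = Suc (part lam k x) \<and> key a lam k x mod 2 = i \<or> y = part lam k x \<and> Suc (key a lam k x) mod 2 = i"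
      using C unfolding addn_tight[OF T] remn_tight[OF T] CD by blast
    have D': "y' = Suc (part lam k x) \<and> key a lam k x mod 2 = i \<or> y' = part lam k x \<and> Suc (key a lam k x) mod 2 = i"
      using D eq unfolding addn_tight[OF T] remn_tight[OF T] CD by blast
    \<comment> \<open>Two different \<open>i\<close>-nodes in one row would be its last node and its
      extension, whose residues differ.\<close>
    have "key a lam k x mod 2 \<noteq> Suc (key a lam k x) mod 2" by presburger
    then show False using C' D' ne eq CD by auto
  qed
  then show "above C D \<or> above D C" unfolding above_def CD by auto
qed (simp_all add: finite_addn finite_remn)

text \<open>The signature lists the \<open>i\<close>-nodes of a tight multipartition in the order of weakly
decreasing keys, which is the order in which the pieces of the path are traversed.\<close>
lemma key_mono_signature:
  assumes T: "tight a b lam"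
    and C: "(k, x, y) \<in> addn a lam i \<union> remn a lam i"
    and D: "(k', x', y') \<in> addn a lam i \<union> remn a lam i"
    and ab: "above (k, x, y) (k', x', y')"
  shows "key a lam k' x' \<le> key a lam k x"
proof -
  have rC: "k < a + b" "1 \<le> x" "x \<le> Suc (rows lam k)"
    and rD: "k' < a + b" "1 \<le> x'" "x' \<le> Suc (rows lam k')"
    using C D by (auto simp: addn_tight[OF T] remn_tight[OF T])
  show ?thesis
  proof (cases "k = k'")
    case True
    then show ?thesis using key_mono[OF T rC(1,2), of x'] ab rD(3) by (simp add: above_def)
  next
    case False
    then have kk: "k < k'" using ab by (simp add: above_def)
    show ?thesis
    proof (cases "lam ! k' = []")
      case False
      show ?thesis
        using key_top_le_bottom[OF T kk rD(1) False] key_ge_bottom[OF T rC]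
          key_mono[OF T rD(1) _ rD(2,3)] by simp
    next
      case True
      \<comment> \<open>An empty component offers only its corner, of key
        \<open>charge a k'\<close>. The order could fail only for key 0 above and charge 1 below,
        but then both nodes are addable with opposite residues.\<close>
      then have x': "x' = 1" using rD by simp
      then have kD: "key a lam k' x' = charge a k'" using True by (simp add: key_alt part_beyond)
      have "key a lam k' x' mod 2 = i" using D True x'
        by (auto simp: addn_tight[OF T] remn_tight[OF T])
      then have Dres: "charge a k' mod 2 = i" by (simp only: kD)
      show ?thesis
      proof (rule ccontr)
        assume "\<not> ?thesis"
        then have z: "key a lam k x = 0" "\<not> k' < a" using kD by (auto split: if_splits)
        then have "part lam k x = 0" using rC by (simp add: key_alt)
        then have "(k, x, y) \<notin> remn a lam i" by (auto simp: remn_def)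
        then have "i = 0" using C z by (auto simp: addn_tight[OF T])
        then show False using Dres z by simp
      qed
    qed
  qed
qed

definition key_cut :: "nat \<Rightarrow> mpart \<Rightarrow> nat \<Rightarrow> nat \<Rightarrow> node set" where
  "key_cut a lam i p = {(k, x, y) \<in> addn a lam i \<union> remn a lam i. p \<le> key a lam k x}"

lemma prefix_key_cut:
  assumes T: "tight a b lam"
  shows "signature.prefix (addn a lam i) (remn a lam i) (key_cut a lam i p)"
  unfolding signature.prefix_def[OF signature_tight[OF T]] key_cut_def
proof (intro conjI ballI impI)
  fix D C assume D: "D \<in> {(k, x, y). (k, x, y) \<in> addn a lam i \<union> remn a lam i \<and> p \<le> key a lam k x}"
    and C: "C \<in> addn a lam i \<union> remn a lam i" and ab: "above C D"
  obtain k x y k' x' y' where CD: "C = (k, x, y)" "D = (k', x', y')" by (metis prod_cases3)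
  have "key a lam k' x' \<le> key a lam k x"
    by (rule key_mono_signature[OF T]) (use C D ab CD in auto)
  then show "C \<in> {(k, x, y). (k, x, y) \<in> addn a lam i \<union> remn a lam i \<and> p \<le> key a lam k x}"
    using C D CD by auto
qed auto

text \<open>The sign with which a row ending at level \<open>q\<close> enters the signature cut at
  \<open>p\<close>. Its increments in \<open>q\<close> are the coefficients of the level counts in
  \<open>dip\<close>: 0 before \<open>p\<close>, 1 at \<open>p\<close>, and alternately -2 and 2
  afterwards.\<close>

definition sgn_from :: "nat \<Rightarrow> nat \<Rightarrow> int" where
  "sgn_from p q = (if p \<le> q then (if even (q + p) then 1 else -1) else 0)"

section \<open>Dips as partial sums of the signature\<close>

lemma ydiag_Sigma:
  "ydiag lam = (SIGMA k:{..<length lam}. SIGMA x:{1..rows lam k}. {1..part lam k x})"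
  by (auto simp: ydiag_def part_def split: if_splits)

lemma finite_ydiag: "finite (ydiag lam)"
  unfolding ydiag_Sigma by auto

lemma sum_by_level:
  assumes "\<And>n. n \<in> ydiag lam \<Longrightarrow> 1 \<le> level a n \<and> level a n \<le> K"
  shows "(\<Sum>q = 1..K. f q * int (level_count a lam q)) = (\<Sum>n\<in>ydiag lam. f (level a n))"
proof -
  have "(\<Sum>q = 1..K. f q * int (level_count a lam q))
      = (\<Sum>q = 1..K. \<Sum>n\<in>{n \<in> ydiag lam. level a n = q}. f (level a n))"
    by (rule sum.cong) (auto simp: level_count_def)
  also have "\<dots> = (\<Sum>n\<in>ydiag lam. f (level a n))"
    by (rule sum.group) (use assms finite_ydiag in auto)
  finally show ?thesis .
qed

lemma dip_telescope:
  assumes "1 \<le> p" "even (p + j)"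
    and "\<And>q. K < q \<Longrightarrow> c q = 0"
  shows "dip K c j p = (\<Sum>q = 1..K. (sgn_from p q - sgn_from p (q - 1)) * int (c q))"
proof (cases "p \<le> K")
  case True
  have eq: "{1..K} = {1..<p} \<union> ({p} \<union> {Suc p..K})" using assms(1) True by auto
  have "(\<Sum>q = 1..K. (sgn_from p q - sgn_from p (q - 1)) * int (c q))
     = (\<Sum>q = 1..<p. (sgn_from p q - sgn_from p (q - 1)) * int (c q))
     + ((sgn_from p p - sgn_from p (p - 1)) * int (c p)
     + (\<Sum>q = Suc p..K. (sgn_from p q - sgn_from p (q - 1)) * int (c q)))"
    unfolding eq by (subst sum.union_disjoint; (subst sum.union_disjoint)?) auto
  also have "(\<Sum>q = 1..<p. (sgn_from p q - sgn_from p (q - 1)) * int (c q)) = 0"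
    by (rule sum.neutral) (auto simp: sgn_from_def)
  also have "(\<Sum>q = Suc p..K. (sgn_from p q - sgn_from p (q - 1)) * int (c q))
     = (\<Sum>q = Suc p..K. - 2 * (alt_sign j q * int (c q)))"
  proof (rule sum.cong[OF refl])
    fix q assume "q \<in> {Suc p..K}"
    then obtain q0 where q: "q = Suc q0" "p \<le> q0" by (cases q) auto
    have "even (q0 + p) \<longleftrightarrow> even (q0 + j)" using assms(2) by presburger
    then have "sgn_from p q - sgn_from p (q - 1) = - 2 * alt_sign j q"
      using q by (simp add: sgn_from_def alt_sign_def)
    then show "(sgn_from p q - sgn_from p (q - 1)) * int (c q) = - 2 * (alt_sign j q * int (c q))" by simp
  qed
  also have "\<dots> = - 2 * alt_tail K c j p" by (simp only: alt_tail_def sum_distrib_left)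
  also have "(sgn_from p p - sgn_from p (p - 1)) = 1" using assms(1) by (simp add: sgn_from_def)
  finally show ?thesis by (simp add: dip_def)
next
  case False
  then have "(\<Sum>q = 1..K. (sgn_from p q - sgn_from p (q - 1)) * int (c q)) = 0"
    by (intro sum.neutral) (auto simp: sgn_from_def)
  moreover have "c p = 0" using False assms(3) by simp
  ultimately show ?thesis using False by (simp add: dip_def alt_tail_def)
qed

lemma sgn_from_row:
  assumes "1 \<le> x"
  shows "(\<Sum>y = 1..m. sgn_from p (level a (k, x, y)) - sgn_from p (level a (k, x, y) - 1))
    = sgn_from p (m + (x - 1) + charge a k) - sgn_from p (x - 1 + charge a k)"
proof -
  obtain x0 where "x = Suc x0" using assms by (cases x) auto
  then show ?thesis by (induction m) (auto simp: level_def add_ac)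
qed

text \<open>Telescoping along each row leaves a boundary term at the row's start. Within one
  component these terms alternate and collapse to 0 or 1, which is the contribution of the addable
  node in the first empty row.\<close>

lemma sgn_from_starts:
  assumes "1 \<le> p" "s \<le> 1"
  shows "(\<Sum>x = 1..l. sgn_from p (x - 1 + s)) = (if p \<le> l + s \<and> odd (l + s + p) then 1 else 0)"
proof (induction l)
  case 0
  have "p \<le> s \<Longrightarrow> p = 1 \<and> s = 1" using assms by simp
  then show ?case by auto
next
  case (Suc l)
  have step: "(\<Sum>x = 1..Suc l. sgn_from p (x - 1 + s))
      = (if p \<le> l + s \<and> odd (l + s + p) then 1 else 0) + sgn_from p (l + s)"
    using Suc by simp
  also have "\<dots> = (if p \<le> Suc l + s \<and> odd (Suc l + s + p) then 1 else 0)"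
  proof -
    define m where "m = l + s"
    consider "p \<le> m" | "p = Suc m" | "Suc m < p" by linarith
    then have "(if p \<le> m \<and> odd (m + p) then 1 else 0) + sgn_from p m
      = (if p \<le> Suc m \<and> odd (Suc m + p) then 1 else 0)"
      by cases (simp_all add: sgn_from_def)
    then show ?thesis by (simp add: m_def del: even_add)
  qed
  finally show ?case .
qed

lemma dip_level_count:
  assumes T: "tight a b lam" and p: "1 \<le> p" "even (p + j)"
    and K: "\<And>n. n \<in> ydiag lam \<Longrightarrow> level a n \<le> K"
  shows "dip K (level_count a lam) j p
    = (\<Sum>k<a + b. (\<Sum>x = 1..rows lam k. sgn_from p (key a lam k x))
        - (if p \<le> rows lam k + charge a k \<and> odd (rows lam k + charge a k + p) then 1 else 0))"
proof -
  have lev: "1 \<le> level a n \<and> level a n \<le> K" if "n \<in> ydiag lam" for n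
    using K[OF that] that by (auto simp: ydiag_def level_def)
  have z: "level_count a lam q = 0" if "K < q" for q
  proof -
    have "level a n \<noteq> q" if "n \<in> ydiag lam" for n using K[OF that] \<open>K < q\<close> by simp
    then have "{n \<in> ydiag lam. level a n = q} = {}" by blast
    then show ?thesis unfolding level_count_def by (simp only: card.empty)
  qed
  have len: "length lam = a + b" using T by (simp add: tight_def)
  have "dip K (level_count a lam) j p
      = (\<Sum>q = 1..K. (sgn_from p q - sgn_from p (q - 1)) * int (level_count a lam q))"
    by (rule dip_telescope[OF p]) (rule z)
  also have "\<dots> = (\<Sum>n\<in>ydiag lam. sgn_from p (level a n) - sgn_from p (level a n - 1))"
    by (rule sum_by_level) (rule lev)
  also have "\<dots> = (\<Sum>k<a + b. \<Sum>x = 1..rows lam k. \<Sum>y = 1..part lam k x.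
      sgn_from p (level a (k, x, y)) - sgn_from p (level a (k, x, y) - 1))"
    unfolding ydiag_Sigma len by (simp add: sum.Sigma[symmetric] split_def sum.Sigma)
  also have "\<dots> = (\<Sum>k<a + b. \<Sum>x = 1..rows lam k. sgn_from p (key a lam k x) - sgn_from p (x - 1 + charge a k))"
    by (intro sum.cong refl, subst sgn_from_row) (auto simp: key_alt)
  also have "\<dots> = (\<Sum>k<a + b. (\<Sum>x = 1..rows lam k. sgn_from p (key a lam k x))
        - (if p \<le> rows lam k + charge a k \<and> odd (rows lam k + charge a k + p) then 1 else 0))"
    by (intro sum.cong refl, unfold sum_subtractf, subst sgn_from_starts[OF p(1)]) auto
  finally show ?thesis .
qed

lemma sum_sgn_from:
  "(\<Sum>x\<in>{1..l::nat}. sgn_from p (f x))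
    = int (card {x \<in> {1..l}. p \<le> f x \<and> even (f x + p)}) - int (card {x \<in> {1..l}. p \<le> f x \<and> odd (f x + p)})"
proof -
  have "sgn_from p (f x) = (if p \<le> f x \<and> even (f x + p) then 1 else 0) - (if p \<le> f x \<and> odd (f x + p) then 1 else 0)" for x
    by (simp add: sgn_from_def)
  then show ?thesis
    by (simp add: sum_subtractf sum.If_cases Int_def)
qed

text \<open>Row by row, a removable \<open>i\<close>-node has key of the parity of \<open>p\<close>
  and an addable one the opposite parity, so the signed count of rows agrees with
  \<open>dip_level_count\<close>. The first empty row of each component supplies the correction
  term.\<close>

lemma excess_key_cut:
  assumes T: "tight a b lam" and p: "1 \<le> p" "even (p + j)" and i: "i = Suc j mod 2"
    and K: "\<And>n. n \<in> ydiag lam \<Longrightarrow> level a n \<le> K"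
  shows "excess (remn a lam i) (addn a lam i) (key_cut a lam i p) = dip K (level_count a lam) j p"
proof -
  have par: "Suc q mod 2 = i \<longleftrightarrow> even (q + p)" "q mod 2 = i \<longleftrightarrow> odd (q + p)" for q
    using p(2) unfolding i by (auto simp: mod2_eq_if)
  define e where "e = (\<lambda>k. {x \<in> {1..rows lam k}. p \<le> key a lam k x \<and> even (key a lam k x + p)})"
  define d where "d = (\<lambda>k. {x \<in> {1..rows lam k}. p \<le> key a lam k x \<and> odd (key a lam k x + p)})"
  define d' where "d' = (\<lambda>k. {x \<in> {1..Suc (rows lam k)}. p \<le> key a lam k x \<and> odd (key a lam k x + p)})"
  have R: "remn a lam i \<inter> key_cut a lam i p = (\<lambda>(k, x). (k, x, part lam k x)) ` (SIGMA k:{..<a + b}. e k)"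
    unfolding key_cut_def remn_tight[OF T] e_def par by auto
  have A: "addn a lam i \<inter> key_cut a lam i p = (\<lambda>(k, x). (k, x, Suc (part lam k x))) ` (SIGMA k:{..<a + b}. d' k)"
    unfolding key_cut_def addn_tight[OF T] d'_def par by auto
  have "card (remn a lam i \<inter> key_cut a lam i p) = card (SIGMA k:{..<a + b}. e k)"
    unfolding R by (rule card_image) (auto simp: inj_on_def)
  then have cR: "card (remn a lam i \<inter> key_cut a lam i p) = (\<Sum>k<a + b. card (e k))"
    by (simp add: e_def)
  have "card (addn a lam i \<inter> key_cut a lam i p) = card (SIGMA k:{..<a + b}. d' k)"
    unfolding A by (rule card_image) (auto simp: inj_on_def)
  then have cA: "card (addn a lam i \<inter> key_cut a lam i p) = (\<Sum>k<a + b. card (d' k))"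
    by (simp add: d'_def)
  have d': "card (d' k) = card (d k)
      + (if p \<le> rows lam k + charge a k \<and> odd (rows lam k + charge a k + p) then 1 else 0)" for k
  proof -
    have "d' k = d k \<union> (if p \<le> rows lam k + charge a k \<and> odd (rows lam k + charge a k + p) then {Suc (rows lam k)} else {})"
      unfolding d'_def d_def key_bottom[of a lam k, symmetric] by (auto simp: le_Suc_eq)
    then show ?thesis by (auto simp: d_def card_insert_if)
  qed
  have "excess (remn a lam i) (addn a lam i) (key_cut a lam i p)
     = (\<Sum>k<a + b. int (card (e k)) - int (card (d k))
        - (if p \<le> rows lam k + charge a k \<and> odd (rows lam k + charge a k + p) then 1 else 0))"
    unfolding excess_def cR cA d' of_nat_sum sum_subtractf[symmetric] by (rule sum.cong) auto
  also have "\<dots> = dip K (level_count a lam) j p"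
    unfolding e_def d_def sum_sgn_from[symmetric]
    by (rule dip_level_count[OF T p, symmetric]) (rule K)
  finally show ?thesis .
qed

text \<open>The cogood node has key \<open>j - 1\<close>, so it lies in the cut at \<open>p\<close>
  exactly when \<open>p < j\<close>. The two survivor lemmas thus compare each dip with the excess
  of all nodes above it, and that excess is identified with the dip of index
  \<open>j\<close>.\<close>

lemma cogood_dips:
  assumes T: "tight a b lam" and B: "cogood a lam i (k, x, y)" and j: "j = level a (k, x, y)"
    and K: "\<And>n. n \<in> ydiag lam \<Longrightarrow> level a n \<le> K"
  shows "i = Suc j mod 2" "1 \<le> j"
    "j < p \<Longrightarrow> even (p + j) \<Longrightarrow> dip K (level_count a lam) j p \<le> dip K (level_count a lam) j j"
    "1 \<le> p \<Longrightarrow> p < j \<Longrightarrow> even (p + j) \<Longrightarrow> dip K (level_count a lam) j p < dip K (level_count a lam) j j"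
proof -
  let ?A = "addn a lam i" and ?R = "remn a lam i"
  interpret signature ?A ?R by (rule signature_tight[OF T])
  have BA: "(k, x, y) \<in> ?A" using B by (simp add: cogood_def conormal_def)
  have surv: "survives n \<longleftrightarrow> conormal a lam i n" for n
    by (simp add: survives_def conormal_def)
  have jk: "j = Suc (key a lam k x)" "1 \<le> x" using BA j
    by (auto simp: addn_tight[OF T] level_def key_def)
  show ij: "i = Suc j mod 2" using BA jk by (auto simp: addn_tight[OF T])
  show j1: "1 \<le> j" using jk by simp
  have sB: "survives (k, x, y)" using B by (simp add: surv cogood_def)
  have first: "n = (k, x, y) \<or> above (k, x, y) n" if "survives n" for n
    using B that by (simp only: surv cogood_def)
  define U where "U = {D \<in> ?A \<union> ?R. above D (k, x, y)}"
  have cut: "(k, x, y) \<in> key_cut a lam i p \<longleftrightarrow> p < j" for p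
    using BA jk by (auto simp: key_cut_def)
  have W: "W (key_cut a lam i p) = dip K (level_count a lam) j p" if "1 \<le> p" "even (p + j)" for p
    by (rule excess_key_cut[OF T that ij K])
  have low: "W (key_cut a lam i p) \<le> W U" if "j \<le> p" for p
    unfolding U_def by (rule excess_before_first_survivor[OF sB first prefix_key_cut[OF T]])
      (use cut that in auto)
  have high: "W (key_cut a lam i p) < W U" if "p < j" for p
    unfolding U_def by (rule excess_after_survivor[OF sB prefix_key_cut[OF T]])
      (use cut that in auto)
  have sub: "key_cut a lam i j \<subseteq> U"
  proof
    fix D assume D: "D \<in> key_cut a lam i j"
    have "D \<noteq> (k, x, y)" using D cut[of j] by auto
    moreover have "\<not> above (k, x, y) D"
      using prefix_key_cut[OF T, of i j] D BA cut[of j] unfolding prefix_def by blast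
    moreover have "D \<in> ?A \<union> ?R" using D by (auto simp: key_cut_def)
    ultimately show "D \<in> U" using total[of D "(k, x, y)"] BA by (auto simp: U_def)
  qed
  \<comment> \<open>The nodes above the cogood node but outside the cut at \<open>j\<close> have its
    key, hence are addable like it. So \<open>W U\<close> is at most the excess of the cut, and
    \<open>low\<close> at \<open>j\<close> gives the converse.\<close>
  have "D \<notin> ?R" if D: "D \<in> U - key_cut a lam i j" for D
  proof
    assume DR: "D \<in> ?R"
    obtain k' x' y' where D': "D = (k', x', y')" by (metis prod_cases3)
    have "key a lam k x \<le> key a lam k' x'"
      by (rule key_mono_signature[OF T]) (use D D' BA in \<open>auto simp: U_def\<close>)
    moreover have "key a lam k' x' < j" using D D' by (auto simp: U_def key_cut_def)
    ultimately have "key a lam k' x' = key a lam k x" using jk by simp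
    then have "Suc (key a lam k x) mod 2 = i" "key a lam k x mod 2 = i"
      using DR BA D' by (auto simp: addn_tight[OF T] remn_tight[OF T])
    then show False by presburger
  qed
  then have "?R \<inter> (U - key_cut a lam i j) = {}" by auto
  then have "W (U - key_cut a lam i j) \<le> 0" by (simp add: excess_def)
  moreover have "W U = W (key_cut a lam i j) + W (U - key_cut a lam i j)"
    using excess_Un[OF fin(2,1), of "key_cut a lam i j" "U - key_cut a lam i j"] sub
    by (simp add: Un_absorb1)
  ultimately have top: "W U = dip K (level_count a lam) j j"
    using low[of j] W[of j] j1 by simp
  show "j < p \<Longrightarrow> even (p + j) \<Longrightarrow> dip K (level_count a lam) j p \<le> dip K (level_count a lam) j j"
    using low[of p] W[of p] top by simp
  show "1 \<le> p \<Longrightarrow> p < j \<Longrightarrow> even (p + j) \<Longrightarrow> dip K (level_count a lam) j p < dip K (level_count a lam) j j"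
    using high[of p] W[of p] top by simp
qed

section \<open>Adding a node\<close>

lemma add_node_simps:
  assumes wf: "wf_mpart r mu" and B: "(k, x, y) \<in> addn a mu i"
  shows "length (add_node mu (k, x, y)) = r"
    and "rows (add_node mu (k, x, y)) k' = (if k' = k then max (rows mu k) x else rows mu k')"
    and "1 \<le> x'' \<Longrightarrow> part (add_node mu (k, x, y)) k' x'' = (if k' = k \<and> x'' = x then y else part mu k' x'')"
    and "k < r" "1 \<le> x" "x \<le> Suc (rows mu k)" "y = Suc (part mu k x)"
    and "x = 1 \<or> y \<le> part mu k (x - 1)"
proof -
  show k: "k < r" and x: "1 \<le> x" and y: "y = Suc (part mu k x)" and xy: "x = 1 \<or> y \<le> part mu k (x - 1)"
    using B wf by (auto simp: addn_def wf_mpart_def)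
  show xl: "x \<le> Suc (rows mu k)"
    using xy y part_beyond[of mu k "x - 1"] by (cases "x - 1 \<le> rows mu k") auto
  have len: "length mu = r" using wf by (simp add: wf_mpart_def)
  show "length (add_node mu (k, x, y)) = r" by (simp add: add_node_def len Let_def)
  show "rows (add_node mu (k, x, y)) k' = (if k' = k then max (rows mu k) x else rows mu k')"
    using k len xl by (auto simp: add_node_def Let_def)
  show "part (add_node mu (k, x, y)) k' x'' = (if k' = k \<and> x'' = x then y else part mu k' x'')"
    if "1 \<le> x''"
    using k len xl x that by (auto simp: part_def add_node_def Let_def nth_list_update nth_append)
qed

lemma wf_add_node:
  assumes wf: "wf_mpart r mu" and B: "(k, x, y) \<in> addn a mu i"
  shows "wf_mpart r (add_node mu (k, x, y))"
proof -
  define lam where "lam = add_node mu (k, x, y)"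
  note S = add_node_simps[OF wf B, folded lam_def]
  have "wf_mpart r lam"
    unfolding wf_mpart_def
  proof (intro conjI allI impI)
    show "length lam = r" by (rule S)
    fix k' x' assume k': "k' < r"
    show "0 < part lam k' x'" if x': "1 \<le> x' \<and> x' \<le> rows lam k'"
    proof (cases "k' = k \<and> x' = x")
      case True
      then show ?thesis using S(5,7) by (simp add: S(3))
    next
      case False
      then have "x' \<le> rows mu k'" using x' S(6) S(2)[of k'] by (auto split: if_splits)
      then show ?thesis using False x' wf k' by (auto simp: S(3) wf_mpart_def)
    qed
    show "part lam k' (Suc x') \<le> part lam k' x'" if x': "1 \<le> x'"
    proof -
      have "part mu k' (Suc x') \<le> part mu k' x'" using wf k' x' by (auto simp: wf_mpart_def)
      then show ?thesis using x' S(7,8) by (auto simp: S(3))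
    qed
  qed
  then show ?thesis by (simp add: lam_def)
qed

lemma ydiag_add_node:
  assumes wf: "wf_mpart r mu" and B: "(k, x, y) \<in> addn a mu i"
  shows "ydiag (add_node mu (k, x, y)) = insert (k, x, y) (ydiag mu)" "(k, x, y) \<notin> ydiag mu"
proof -
  define lam where "lam = add_node mu (k, x, y)"
  note S = add_node_simps[OF wf B, folded lam_def]
  have len: "length mu = r" using wf by (simp add: wf_mpart_def)
  have "ydiag lam = insert (k, x, y) (ydiag mu)"
    using S(4,5,7) by (auto simp: ydiag_def S(1,3) len split: if_splits)
  then show "ydiag (add_node mu (k, x, y)) = insert (k, x, y) (ydiag mu)" by (simp only: lam_def)
  show "(k, x, y) \<notin> ydiag mu" using S(7) by (simp add: ydiag_def)
qed

lemma level_count_add_node: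
  assumes wf: "wf_mpart r mu" and B: "(k, x, y) \<in> addn a mu i"
  shows "level_count a (add_node mu (k, x, y))
    = (level_count a mu)(level a (k, x, y) := Suc (level_count a mu (level a (k, x, y))))"
proof
  fix j
  note Y = ydiag_add_node[OF wf B]
  have "{n \<in> ydiag (add_node mu (k, x, y)). level a n = j}
    = (if j = level a (k, x, y) then insert (k, x, y) {n \<in> ydiag mu. level a n = j} else {n \<in> ydiag mu. level a n = j})"
    unfolding Y(1) by auto
  then show "level_count a (add_node mu (k, x, y)) j
    = ((level_count a mu)(level a (k, x, y) := Suc (level_count a mu (level a (k, x, y))))) j"
    using Y(2) finite_ydiag[of mu] by (simp add: level_count_def)
qed

text \<open>The stretch from \<open>B\<close> down to \<open>C\<close> then holds a removable node
  but no addable one, so \<open>B\<close> is cancelled.\<close>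

lemma not_conormal:
  assumes "C \<in> remn a mu i" "above B C" "\<And>D. D \<in> addn a mu i \<Longrightarrow> above B D \<Longrightarrow> above C D"
  shows "\<not> conormal a mu i B"
proof
  assume "conormal a mu i B"
  define RC where "RC = {D \<in> remn a mu i. above B D \<and> \<not> above C D}"
  define AC where "AC = {D \<in> addn a mu i. above B D \<and> \<not> above C D}"
  have "card RC \<le> card AC"
    using \<open>conormal a mu i B\<close> assms(1,2) unfolding conormal_def RC_def AC_def by blast
  moreover have "AC = {}" using assms(3) unfolding AC_def by blast
  moreover have "C \<in> RC" using assms(1,2) above_irrefl by (simp add: RC_def)
  moreover have "finite RC" using finite_remn by (simp add: RC_def)
  ultimately show False by auto
qed

text \<open>Tightness can fail before the addition only if rows \<open>x\<close> and
  \<open>Suc x\<close> have equal length, or if the new node opens a row that the next component's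
  first part requires. In either case a removable node of the same level as the new one follows it,
  with no addable \<open>i\<close>-node in between, so the new node would not be conormal.\<close>

lemma tight_predecessor:
  assumes wf: "wf_mpart (a + b) mu" and T: "tight a b (add_node mu (k, x, y))"
    and con: "conormal a mu i (k, x, y)"
  shows "tight a b mu"
proof -
  define lam where "lam = add_node mu (k, x, y)"
  have B: "(k, x, y) \<in> addn a mu i" using con by (simp add: conormal_def)
  note S = add_node_simps[OF wf B, folded lam_def]
  note T = T[folded lam_def]
  have len: "length mu = a + b" using wf by (simp add: wf_mpart_def)
  have resB: "Suc (level a (k, x, y)) mod 2 = i" using B S(5) by (auto simp: addn_def res_level)
  have dec: "part lam k' (Suc x') < part lam k' x'" if "k' < a + b" "1 \<le> x'" "x' \<le> rows lam k'" for k' x'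
    using T that by (simp add: tight_def)
  have pos: "0 < part mu k' x'" if "k' < a + b" "1 \<le> x'" "x' \<le> rows mu k'" for k' x'
    using wf that by (simp add: wf_mpart_def)
  show ?thesis
    unfolding tight_def
  proof (intro conjI allI impI)
    show "length mu = a + b" by (rule len)
  next
    fix k' x' assume k': "k' < a + b" and x': "1 \<le> x' \<and> x' \<le> rows mu k'"
    then have d: "part lam k' (Suc x') < part lam k' x'"
      by (intro dec) (auto simp: S(2))
    show "part mu k' (Suc x') < part mu k' x'"
    proof (cases "k' = k \<and> x' = x")
      case False
      then show ?thesis using d x' S(7) by (auto simp: S(3) split: if_splits)
    next
      case True
      show ?thesis
      proof (rule ccontr)
        assume "\<not> ?thesis"
        then have p: "part mu k (Suc x) = part mu k x" using d x' True S(7) by (simp add: S(3))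
        have p0: "0 < part mu k x" using pos[OF k'] x' True by simp
        then have r: "Suc x \<le> rows mu k" using p part_beyond[of mu k "Suc x"]
          by (cases "Suc x \<le> rows mu k") auto
        have "part mu k (Suc (Suc x)) < part mu k x"
          using dec[of k "Suc x"] S(4) r p by (simp add: S(2,3))
        moreover have "res a k (Suc x) (part mu k x) = i"
          using resB S(5,7) by (simp add: res_level level_def)
        ultimately have "(k, Suc x, part mu k x) \<in> remn a mu i"
          using p p0 S(4) len by (simp add: remn_def)
        moreover have "above (k, x, y) (k, Suc x, part mu k x)" by (simp add: above_def)
        moreover have "above (k, Suc x, part mu k x) D" if D: "D \<in> addn a mu i" "above (k, x, y) D" for D
        proof -
          obtain k2 x2 y2 where D2: "D = (k2, x2, y2)" by (metis prod_cases3)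
          have "y2 = Suc (part mu k2 x2)" "x2 = 1 \<or> y2 \<le> part mu k2 (x2 - 1)"
            using D(1) D2 by (auto simp: addn_def)
          then have "\<not> (k2 = k \<and> x2 = Suc x)" using p S(5) by auto
          then show ?thesis using D(2) by (auto simp: D2 above_def)
        qed
        ultimately show False using not_conormal con by blast
      qed
    qed
  next
    fix k' assume k': "Suc k' < a + b \<and> mu ! Suc k' \<noteq> []"
    have ne: "1 \<le> rows mu (Suc k')" using k' by (cases "mu ! Suc k'") auto
    then have "lam ! Suc k' \<noteq> []" using S(2)[of "Suc k'"] by (auto split: if_splits)
    then have le: "part lam (Suc k') 1 + (if Suc k' = a then 1 else 0) \<le> rows lam k'"
      using T k' by (simp add: tight_def)
    have ple: "part mu (Suc k') 1 \<le> part lam (Suc k') 1" using S(7) by (simp add: S(3))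
    show "part mu (Suc k') 1 + (if Suc k' = a then 1 else 0) \<le> rows mu k'"
    proof (rule ccontr)
      assume c: "\<not> ?thesis"
      then have kk: "k' = k" and xr: "x = Suc (rows mu k)" "rows lam k = x"
        using le ple S(6) S(2)[of k'] by (auto split: if_splits)
      have y1: "y = 1" using S(7) xr part_beyond[of mu k x] by simp
      define P where "P = part mu (Suc k) 1"
      have P: "P + (if Suc k = a then 1 else 0) = x"
        using c le ple kk xr unfolding P_def by simp
      have P0: "0 < P" using pos[of "Suc k" 1] k' kk ne by (simp add: P_def)
      have lev: "level a (Suc k, 1, P) = level a (k, x, y)"
        using P y1 by (auto simp: level_def)
      have "part mu (Suc k) (Suc 1) < P"
        using dec[of "Suc k" 1] k' kk ne by (simp add: S(2,3) P_def)
      moreover have "res a (Suc k) 1 P = i" using resB lev by (simp add: res_level)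
      ultimately have "(Suc k, 1, P) \<in> remn a mu i"
        using P0 k' kk len by (simp add: remn_def P_def)
      moreover have "above (k, x, y) (Suc k, 1, P)" by (simp add: above_def)
      \<comment> \<open>Component \<open>k\<close> has nothing addable below its first empty row,
        and the extension of the first row of component \<open>Suc k\<close> is one level too high
        to have residue \<open>i\<close>.\<close>
      moreover have "above (Suc k, 1, P) D" if D: "D \<in> addn a mu i" "above (k, x, y) D" for D
      proof -
        obtain k2 x2 y2 where D2: "D = (k2, x2, y2)" by (metis prod_cases3)
        have D3: "1 \<le> x2" "y2 = Suc (part mu k2 x2)" "x2 = 1 \<or> y2 \<le> part mu k2 (x2 - 1)"
          "Suc (level a (k2, x2, y2)) mod 2 = i"
          using D(1) D2 by (auto simp: addn_def res_level)
        have "k2 \<noteq> k"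
        proof
          assume "k2 = k"
          then have "x < x2" using D(2) D2 by (simp add: above_def)
          then have "part mu k (x2 - 1) = 0" "x2 \<noteq> 1" using xr by (simp_all add: part_beyond)
          then show False using D3(2,3) \<open>k2 = k\<close> by simp
        qed
        moreover have "\<not> (k2 = Suc k \<and> x2 = 1)"
        proof
          assume eq: "k2 = Suc k \<and> x2 = 1"
          then have "level a (k2, x2, y2) = Suc (level a (Suc k, 1, P))"
            using D3(2) P0 by (auto simp: level_def P_def)
          then show False using D3(4) resB lev by presburger
        qed
        ultimately show ?thesis using D(2) D3(1) by (auto simp: D2 above_def)
      qed
      ultimately show False using not_conormal con by blast
    qed
  qed
qed

section \<open>The sequence of level counts of a tight multipartition\<close>

text \<open>Levels increase by one along a row, so a row meets a level at most once, namely when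
  that level lies between its first node's level and its \<open>key\<close>.\<close>

lemma level_count_rows:
  assumes "length lam = r"
  shows "level_count a lam q
    = (\<Sum>k<r. card {x \<in> {1..rows lam k}. x + charge a k \<le> q \<and> q \<le> key a lam k x})"
proof -
  define F where "F = (\<lambda>k. {x \<in> {1..rows lam k}. x + charge a k \<le> q \<and> q \<le> key a lam k x})"
  have "{n \<in> ydiag lam. level a n = q} = (\<lambda>(k, x). (k, x, Suc q - x - charge a k)) ` (SIGMA k:{..<r}. F k)"
  proof (intro set_eqI iffI)
    fix n assume "n \<in> {n \<in> ydiag lam. level a n = q}"
    then obtain k x y where n: "n = (k, x, y)" "k < r" "1 \<le> x" "x \<le> rows lam k" "1 \<le> y"
      "y \<le> part lam k x" "x + y + charge a k - 1 = q"
      by (auto simp: ydiag_Sigma assms level_def)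
    then have "x \<in> F k" "y = Suc q - x - charge a k" by (auto simp: F_def key_alt)
    then show "n \<in> (\<lambda>(k, x). (k, x, Suc q - x - charge a k)) ` (SIGMA k:{..<r}. F k)"
      using n by force
  next
    fix n assume "n \<in> (\<lambda>(k, x). (k, x, Suc q - x - charge a k)) ` (SIGMA k:{..<r}. F k)"
    then obtain k x where n: "n = (k, x, Suc q - x - charge a k)" "k < r" "x \<in> F k" by auto
    then have "1 \<le> x" "x \<le> rows lam k" "x + charge a k \<le> q" "q \<le> part lam k x + (x - 1) + charge a k"
      by (auto simp: F_def key_alt)
    then show "n \<in> {n \<in> ydiag lam. level a n = q}"
      using n(1,2) by (auto simp: ydiag_Sigma assms level_def)
  qed
  then have "level_count a lam q = card ((\<lambda>(k, x). (k, x, Suc q - x - charge a k)) ` (SIGMA k:{..<r}. F k))"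
    by (simp add: level_count_def)
  also have "\<dots> = card (SIGMA k:{..<r}. F k)" by (rule card_image) (auto simp: inj_on_def)
  also have "\<dots> = (\<Sum>k<r. card (F k))" by (simp add: F_def)
  finally show ?thesis by (simp add: F_def)
qed

lemma full_components_initial:
  assumes T: "tight a b lam" and "k < k'" "k' < a + b" and q: "1 \<le> q"
    and "Suc q \<le> rows lam k' + charge a k'"
  shows "Suc q \<le> rows lam k + charge a k"
proof -
  have ne: "lam ! k' \<noteq> []" using q assms(5) by (auto split: if_splits)
  have "rows lam k' + charge a k' \<le> key a lam k' 1"
    using key_ge_bottom[OF T assms(3)] by simp
  then show ?thesis using key_top_le_bottom[OF T assms(2,3) ne] assms(5) by linarith
qed

lemma down_closed_nat:
  fixes S :: "nat set"
  assumes "finite S" "\<And>x y. x < y \<Longrightarrow> y \<in> S \<Longrightarrow> x \<in> S"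
  obtains m where "S = {..<m}"
proof (cases "S = {}")
  case True
  then show ?thesis using that[of 0] by simp
next
  case False
  have "S = {..<Suc (Max S)}"
  proof (intro set_eqI iffI)
    fix x assume "x \<in> {..<Suc (Max S)}"
    then have "x = Max S \<or> x < Max S" by auto
    then show "x \<in> S" using assms(2)[of x "Max S"] Max_in[OF assms(1) False] by auto
  qed (use assms(1) in \<open>simp add: less_Suc_eq_le\<close>)
  then show ?thesis by (rule that)
qed

lemma dlev_Suc: "1 \<le> q \<Longrightarrow> dlev a b (Suc q) = dlev a b q + (a + b)"
  by (cases q) (simp_all add: dlev_def algebra_simps)

text \<open>d_q is the sum of \<open>q - charge a k\<close> over all components. The larger terms
  come first, so the mean over the first \<open>m\<close> components is at least the overall
  mean.\<close>

lemma dlev_initial: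
  assumes "m \<le> a + b" "1 \<le> q"
  shows "m * dlev a b q \<le> (a + b) * (\<Sum>k<m. q - charge a k)"
proof -
  obtain q0 where q: "q = Suc q0" using assms(2) by (cases q) auto
  show ?thesis
  proof (cases "m \<le> a")
    case True
    then have "(\<Sum>k<m. q - charge a k) = m * q" by simp
    moreover have "dlev a b q \<le> (a + b) * q" by (simp add: dlev_def q algebra_simps)
    ultimately show ?thesis by (simp add: mult_ac)
  next
    case False
    then obtain n where m: "m = a + n" by (metis le_add_diff_inverse nat_le_linear)
    have "(\<Sum>k<a + n. q - charge a k) = a * q + n * q0"
      by (induction n) (auto simp: q)
    moreover have "n \<le> b" using assms(1) m by simp
    then have "a * n \<le> a * b" by simp
    ultimately show ?thesis unfolding m dlev_def q by (simp add: algebra_simps)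
  qed
qed

text \<open>As d_{q+1} = d_q + (a + b), the claim reduces to (c_{q+1} - c_q) d_q \<le> (a + b) c_q.
  From level q to q+1 a component gains at most one row, and only if it reaches that far down. The
  \<open>m\<close> components that do form an initial segment and contain all their possible nodes
  of level q, so \<open>dlev_initial\<close> applies.\<close>

lemma ls_seq_tight:
  assumes T: "tight a b lam"
  shows "ls_seq a b (level_count a lam)"
  unfolding ls_seq_def
proof (intro conjI allI impI)
  have len: "length lam = a + b" using T by (simp add: tight_def)
  define F where "F = (\<lambda>q k. {x \<in> {1..rows lam k}. x + charge a k \<le> q \<and> q \<le> key a lam k x})"
  have cF: "level_count a lam q = (\<Sum>k<a + b. card (F q k))" for q
    by (simp add: level_count_rows[OF len] F_def)
  have fin: "finite (F q k)" for q k by (simp add: F_def)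
  have "card (F 1 k) \<le> (if k < a then 1 else 0)" for k
  proof -
    have "F 1 k \<subseteq> (if k < a then {1} else {})" by (auto simp: F_def)
    then have "card (F 1 k) \<le> card (if k < a then {1::nat} else {})" by (intro card_mono) auto
    then show ?thesis by (auto split: if_splits)
  qed
  then have "level_count a lam 1 \<le> (\<Sum>k<a + b. if k < a then 1 else 0)"
    unfolding cF by (rule sum_mono)
  also have "\<dots> = card ({..<a + b} \<inter> {k. k < a})" by (simp add: sum.If_cases)
  also have "{..<a + b} \<inter> {k. k < a} = {..<a}" by auto
  finally show "level_count a lam 1 \<le> a" by simp
  fix q :: nat assume q: "1 \<le> q"
  define M where "M = {k. k < a + b \<and> Suc q \<le> rows lam k + charge a k}"
  have "finite M" by (simp add: M_def)
  moreover have "k \<in> M" if "k < k'" "k' \<in> M" for k k'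
    using full_components_initial[OF T that(1) _ q] that by (auto simp: M_def)
  ultimately obtain m where m: "M = {..<m}" using down_closed_nat by metis
  have mr: "m \<le> a + b" using m by (force simp: M_def set_eq_iff not_less dest: spec[of _ "a + b"])
  have step: "card (F (Suc q) k) \<le> card (F q k) + (if k \<in> M then 1 else 0)" if "k < a + b" for k
  proof -
    have "F (Suc q) k \<subseteq> F q k \<union> (if k \<in> M then {Suc q - charge a k} else {})"
      using that by (auto simp: F_def M_def split: if_splits)
    then have "card (F (Suc q) k) \<le> card (F q k \<union> (if k \<in> M then {Suc q - charge a k} else {}))"
      by (intro card_mono) (auto simp: fin)
    also have "\<dots> \<le> card (F q k) + card (if k \<in> M then {Suc q - charge a k} else {})"
      by (rule card_Un_le)
    finally show ?thesis by (auto split: if_splits)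
  qed
  have "level_count a lam (Suc q) \<le> (\<Sum>k<a + b. card (F q k) + (if k \<in> M then 1 else 0))"
    unfolding cF by (rule sum_mono) (simp add: step)
  also have "\<dots> = level_count a lam q + (\<Sum>k<a + b. if k \<in> M then 1 else 0)"
    by (simp add: sum.distrib cF)
  also have "(\<Sum>k<a + b. if k \<in> M then 1 else (0::nat)) = card ({..<a + b} \<inter> M)"
    by (simp add: sum.If_cases)
  also have "{..<a + b} \<inter> M = {..<m}" unfolding m using mr by auto
  finally have up: "level_count a lam (Suc q) \<le> level_count a lam q + m" by simp
  have "q - charge a k \<le> card (F q k)" if "k < m" for k
  proof -
    have "k \<in> M" unfolding m using that by simp
    then have kM: "k < a + b" "Suc q \<le> rows lam k + charge a k" by (simp_all add: M_def)
    have "{1..q - charge a k} \<subseteq> F q k"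
    proof
      fix x assume x: "x \<in> {1..q - charge a k}"
      then have "x \<le> rows lam k" using kM by auto
      then have "rows lam k + charge a k \<le> key a lam k x"
        using key_ge_bottom[OF T kM(1), of x] x by simp
      then show "x \<in> F q k" using x kM \<open>x \<le> rows lam k\<close> by (auto simp: F_def)
    qed
    from card_mono[OF fin this] show ?thesis by simp
  qed
  then have "(\<Sum>k<m. q - charge a k) \<le> (\<Sum>k<m. card (F q k))" by (intro sum_mono) auto
  also have "\<dots> \<le> level_count a lam q" unfolding cF using mr by (intro sum_mono2) auto
  finally have "m * dlev a b q \<le> (a + b) * level_count a lam q"
    using dlev_initial[OF mr q] by (meson le_trans mult_le_mono2)
  moreover have "level_count a lam (Suc q) * dlev a b q \<le> (level_count a lam q + m) * dlev a b q"
    using up by (rule mult_le_mono1)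
  ultimately show "level_count a lam (Suc q) * dlev a b q \<le> level_count a lam q * dlev a b (Suc q)"
    by (simp add: dlev_Suc[OF q] algebra_simps)
qed

section \<open>Crystal operators\<close>

lemma applyM_snoc: "applyM a (is @ [i]) l = (case applyM a is l of None \<Rightarrow> None | Some l' \<Rightarrow> fm a i l')"
  by (induction "is" arbitrary: l) (auto split: option.splits)

lemma applyP_snoc: "applyP (is @ [i]) p = (case applyP is p of None \<Rightarrow> None | Some p' \<Rightarrow> fp i p')"
  by (induction "is" arbitrary: p) (auto split: option.splits)

lemma fm_cases:
  assumes "fm a i mu = Some lam"
  obtains k x y where "cogood a mu i (k, x, y)" "lam = add_node mu (k, x, y)"
proof -
  obtain B where B: "cogood a mu i B" using assms by (auto simp: fm_def split: if_splits)
  have "(THE B. cogood a mu i B) = B"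
  proof (rule the_equality[of "cogood a mu i", OF B])
    fix B' assume "cogood a mu i B'"
    then show "B' = B" using B above_asym unfolding cogood_def by blast
  qed
  then have "lam = add_node mu B" using assms B by (auto simp: fm_def split: if_splits)
  moreover obtain k x y where "B = (k, x, y)" by (metis prod_cases3)
  ultimately show ?thesis using B that by blast
qed

lemma wf_applyM:
  "applyM a is (replicate r []) = Some lam \<Longrightarrow> wf_mpart r lam"
proof (induction "is" arbitrary: lam rule: rev_induct)
  case Nil
  then show ?case by (auto simp: wf_mpart_def part_def)
next
  case (snoc i "is")
  then obtain mu where mu: "applyM a is (replicate r []) = Some mu" "fm a i mu = Some lam"
    by (auto simp: applyM_snoc split: option.splits)
  obtain k x y where B: "cogood a mu i (k, x, y)" "lam = add_node mu (k, x, y)"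
    using fm_cases[OF mu(2)] by blast
  then show ?case using wf_add_node[OF snoc.IH[OF mu(1)]] by (auto simp: cogood_def conormal_def)
qed

text \<open>Removing the last operator preserves tightness, so the induction hypothesis gives the
  path of the predecessor. The dips at the cogood node are those required by
  \<open>fp_level_path\<close>, and monotonicity of the new breakpoints comes from tightness of the
  result. One strict bound \<open>K\<close> serves for all predecessors, since their diagrams are
  smaller.\<close>

lemma applyP_tight:
  assumes a1: "1 \<le> a"
  shows "applyM a is (replicate (a + b) []) = Some lam \<Longrightarrow> tight a b lam \<Longrightarrow>
    (\<And>n. n \<in> ydiag lam \<Longrightarrow> level a n < K) \<Longrightarrow>
    \<exists>\<pi>. applyP is (straight a b) = Some \<pi> \<and> (\<forall>t\<in>{0..1}. \<pi> t = level_path a b K (level_count a lam) t)"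
proof (induction "is" arbitrary: lam rule: rev_induct)
  case Nil
  then have "ydiag lam = {}" by (auto simp: ydiag_def part_def)
  then show ?case by (auto simp: level_count_def level_path_def straight_def min_absorb2)
next
  case (snoc i "is")
  obtain mu where mu: "applyM a is (replicate (a + b) []) = Some mu" "fm a i mu = Some lam"
    using snoc.prems(1) by (auto simp: applyM_snoc split: option.splits)
  obtain k x y where B: "cogood a mu i (k, x, y)" "lam = add_node mu (k, x, y)"
    using fm_cases[OF mu(2)] by blast
  have con: "conormal a mu i (k, x, y)" and add: "(k, x, y) \<in> addn a mu i"
    using B(1) by (auto simp: cogood_def conormal_def)
  note wf = wf_applyM[OF mu(1)]
  note Y = ydiag_add_node[OF wf add, folded B(2)]
  have T: "tight a b mu" by (rule tight_predecessor[OF wf _ con]) (use snoc.prems(2) B(2) in simp)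
  have lev: "level a n < K" if "n \<in> ydiag mu" for n using snoc.prems(3)[of n] that Y by simp
  obtain \<pi> where pi: "applyP is (straight a b) = Some \<pi>"
    "\<And>t. t \<in> {0..1} \<Longrightarrow> \<pi> t = level_path a b K (level_count a mu) t"
    using snoc.IH[OF mu(1) T lev] by blast
  define j where "j = level a (k, x, y)"
  have jK: "j < K" using snoc.prems(3)[of "(k, x, y)"] Y by (simp add: j_def)
  have le: "level a n \<le> K" if "n \<in> ydiag mu" for n using lev[OF that] by simp
  note D = cogood_dips[OF T B(1) j_def le]
  have c: "level_count a lam = (level_count a mu)(j := Suc (level_count a mu j))"
    unfolding j_def B(2) by (rule level_count_add_node[OF wf add])
  have z: "level_count a mu p = 0" if "K \<le> p" for p
  proof -
    have "level a n \<noteq> p" if "n \<in> ydiag mu" for n using lev[OF that] \<open>K \<le> p\<close> by simp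
    then have "{n \<in> ydiag mu. level a n = p} = {}" by blast
    then show ?thesis unfolding level_count_def by (simp only: card.empty)
  qed
  obtain \<pi>' where "fp i \<pi> = Some \<pi>'"
    "\<And>t. t \<in> {0..1} \<Longrightarrow> \<pi>' t = level_path a b K ((level_count a mu)(j := Suc (level_count a mu j))) t"
    by (rule fp_level_path[OF a1 D(1,2) jK ls_seq_tight[OF T] _ z D(3,4) pi(2)])
      (use ls_seq_tight[OF snoc.prems(2)] c in auto)
  then have "fp i \<pi> = Some \<pi>'" "\<forall>t\<in>{0..1}. \<pi>' t = level_path a b K (level_count a lam) t"
    unfolding c by blast+
  then show ?case using pi(1) by (simp add: applyP_snoc)
qed

text \<open>Strictness comes from the distinct parts of alternating partitions. The terminal
  staircase forces the preceding component to be long enough, and at the border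
  \<open>Suc k = a\<close> the non-increasing option supplies the additional row.\<close>

lemma tight_res_homog:
  assumes "kleshchev a b lam" "res_homog a b lam" "non_increasing a b lam"
  shows "tight a b lam"
proof -
  have wf: "wf_mpart (a + b) lam" using assms(1) wf_applyM by (auto simp: kleshchev_def)
  show ?thesis
    unfolding tight_def
  proof (intro conjI allI impI)
    show "length lam = a + b" using wf by (simp add: wf_mpart_def)
  next
    fix k x assume k: "k < a + b" and x: "1 \<le> x \<and> x \<le> rows lam k"
    have pos: "0 < part lam k x'" if "1 \<le> x'" "x' \<le> rows lam k" for x' using wf k that by (simp add: wf_mpart_def)
    have "z \<noteq> 0" if z: "z \<in> set (lam ! k)" for z
    proof -
      obtain u where "u < rows lam k" "lam ! k ! u = z" using z by (auto simp: in_set_conv_nth)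
      then show ?thesis using pos[of "Suc u"] by (simp add: part_def)
    qed
    then have "filter (\<lambda>z. z \<noteq> 0) (lam ! k) = lam ! k" by (simp add: filter_id_conv)
    moreover have "lam ! k \<noteq> []" using x by auto
    then have "alternating (lam ! k)" using assms(2) k by (simp add: res_homog_def)
    ultimately have d: "distinct (lam ! k)" by (simp add: alternating_def)
    have le: "part lam k (Suc x) \<le> part lam k x" using wf k x by (simp add: wf_mpart_def)
    have "part lam k (Suc x) \<noteq> part lam k x"
    proof (cases "Suc x \<le> rows lam k")
      case True
      then have "lam ! k ! x \<noteq> lam ! k ! (x - 1)" using d x by (auto simp: nth_eq_iff_index_eq)
      then show ?thesis using True x by (simp add: part_def)
    next
      case False
      then show ?thesis using pos[of x] x by (simp add: part_beyond)
    qed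
    then show "part lam k (Suc x) < part lam k x" using le by simp
  next
    fix k assume k: "Suc k < a + b \<and> lam ! Suc k \<noteq> []"
    then have hd: "part lam (Suc k) 1 = hd (lam ! Suc k)" by (cases "lam ! Suc k") (auto simp: part_def)
    have "\<exists>u. lam ! k = u @ stair (hd (lam ! Suc k) + (if Suc k = a then 1 else 0))"
    proof (cases "Suc k = a")
      case True
      then show ?thesis using assms(3) k by (auto simp: non_increasing_def)
    next
      case False
      have "1 \<le> Suc k \<and> Suc k < a + b \<and> lam ! Suc k \<noteq> []" using k by simp
      then have "\<exists>u. lam ! (Suc k - 1) = u @ stair (hd (lam ! Suc k))"
        using assms(2) False unfolding res_homog_def by meson
      then show ?thesis using False by simp
    qed
    then show "part lam (Suc k) 1 + (if Suc k = a then 1 else 0) \<le> rows lam k"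
      unfolding hd by (metis length_append length_stair le_add2)
  qed
qed

text \<open>Keys decrease downwards through all components, so the top row, of charge 0, reaches the
  highest level. Hence the level counts vanish beyond \<open>N\<close>.\<close>

lemma level_le_first_part:
  assumes T: "tight a b lam" and a1: "1 \<le> a" and n: "n \<in> ydiag lam"
  shows "level a n \<le> part lam 0 1"
proof -
  have len: "length lam = a + b" using T by (simp add: tight_def)
  obtain k x y where kx: "n = (k, x, y)" "k < a + b" "1 \<le> x" "x \<le> rows lam k" "y \<le> part lam k x"
    using n by (auto simp: ydiag_Sigma len)
  have "level a n \<le> key a lam k x" using kx by (simp add: key_def level_def)
  also have "\<dots> \<le> key a lam k 1" using key_mono[OF T kx(2) _ kx(3)] kx by simp
  also have "\<dots> \<le> key a lam 0 1"
  proof (cases "k = 0")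
    case False
    have "lam ! k \<noteq> []" using kx by auto
    then have "key a lam k 1 \<le> rows lam 0 + charge a 0" using key_top_le_bottom[OF T _ kx(2)] False by simp
    also have "\<dots> \<le> key a lam 0 1" using key_ge_bottom[OF T, of 0 1] a1 by simp
    finally show ?thesis .
  qed simp
  also have "\<dots> = part lam 0 1" using a1 by (simp add: key_alt)
  finally show ?thesis .
qed

theorem mainTheorem8:
  fixes a b :: nat and lam :: "nat list list"
  assumes "1 \<le> a"
    and "kleshchev a b lam"
    and "res_homog a b lam"
    and "non_increasing a b lam"
    and "lam ! 0 \<noteq> []"
  shows "(\<forall>j \<le> hd (lam ! 0). ecoef a b lam (hd (lam ! 0)) (Suc j) \<le> ecoef a b lam (hd (lam ! 0)) j)
       \<and> littelmann_path_is a b lam (std_path a b lam (hd (lam ! 0)))"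
proof
  let ?N = "hd (lam ! 0)"
  have T: "tight a b lam" by (rule tight_res_homog[OF assms(2-4)])
  then have len: "length lam = a + b" by (simp add: tight_def)
  note ls = ls_seq_tight[OF T]
  show "\<forall>j \<le> ?N. ecoef a b lam ?N (Suc j) \<le> ecoef a b lam ?N j"
    using ecoef_antimono[OF assms(1) len ls] by blast
  have "part lam 0 1 = ?N" using assms(5) by (cases "lam ! 0") (auto simp: part_def)
  then have lev: "level a n \<le> ?N" if "n \<in> ydiag lam" for n
    using level_le_first_part[OF T assms(1) that] by simp
  have z: "level_count a lam p = 0" if "?N < p" for p
  proof -
    have "level a n \<noteq> p" if "n \<in> ydiag lam" for n using lev[OF that] \<open>?N < p\<close> by simp
    then have "{n \<in> ydiag lam. level a n = p} = {}" by blast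
    then show ?thesis unfolding level_count_def by (simp only: card.empty)
  qed
  \<comment> \<open>The bound \<open>Suc ?N\<close> is chosen because the induction over operators
    needs all levels strictly below it.\<close>
  have std: "std_path a b lam ?N t = level_path a b (Suc ?N) (level_count a lam) t" if "t \<in> {0..1}" for t
    by (rule std_path_eq_level_path[OF assms(1) len ls z]) (use that in auto)
  have lt: "level a n < Suc ?N" if "n \<in> ydiag lam" for n using lev[OF that] by simp
  show "littelmann_path_is a b lam (std_path a b lam ?N)"
    unfolding littelmann_path_is_def
  proof (intro allI impI)
    fix "is" assume "applyM a is (replicate (a + b) []) = Some lam"
    from applyP_tight[OF assms(1) this T lt]
    show "\<exists>\<pi>'. applyP is (straight a b) = Some \<pi>' \<and> (\<forall>t\<in>{0..1}. \<pi>' t = std_path a b lam ?N t)"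
      using std by auto
  qed
qed

end
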